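(* Let $K$ be a field and $S=K[x_1,\dots,x_5]$. If $I$ is a squarefree monomial ideal of $S$ with $0\neq I\neq S$, then $\operatorname{sdepth}(I)>\operatorname{sdepth}(S/I)$.
   Context: Stanley depth. Let $K$ be a field, $S=K[x_1,\dots,x_n]$ with its standard $\mathbb{Z}^n$-grading, and let $M$ be a nonzero $\mathbb{Z}^n$-graded $S$-module (here $n=5$ and $M=I$ or $M=S/I$ for a monomial ideal $I$). For a homogeneous element $m\in M$ and a subset $Z\subseteq\{x_1,\dots,x_n\}$, the $K[Z]$-submodule $mK[Z]$ of $M$ is called a Stanley space of dimension $|Z|$ if it is a free $K[Z]$-module. A Stanley decomposition $\mathcal{D}$ of $M$ is a finite direct sum decomposition $M=\bigoplus_{j=1}^r m_jK[Z_j]$ of $M$ as a $\mathbb{Z}^n$-graded $K$-vector space in which each $m_jK[Z_j]$ is a Stanley space of $M$. Put $\operatorname{sdepth}(\mathcal{D})=\min_j|Z_j|$, and let $\operatorname{sdepth}(M)$ be the maximum of $\operatorname{sdepth}(\mathcal{D})$ over all Stanley decompositions $\mathcal{D}$ of $M$. A squarefree monomial ideal is an ideal generated by squarefree monomials. *)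

theory Defs
  imports
    "HOL-Algebra.Algebraic_Closure_Type"
    "HOL-Library.Poly_Mapping"
    "HOL-Library.Numeral_Type"
begin

text \<open>
  A monomial $x^a$ is represented by its exponent vector \<open>a :: 'n \<Rightarrow>\<^sub>0 nat\<close>, where the finite type \<open>'n\<close>
  indexes the variables, and a polynomial by its finitely supported coefficient function.
  The multiplication that HOL-Library provides on this type is convolution, i.e. the
  product of polynomials; \<open>ring_of_type_algebra\<close> turns the type into a ring with carrier \<open>UNIV\<close>.
\<close>

type_synonym ('n, 'k) mpoly = "('n \<Rightarrow>\<^sub>0 nat) \<Rightarrow>\<^sub>0 'k"

abbreviation mpoly_ring :: "('n, 'k::field) mpoly ring" where
  "mpoly_ring \<equiv> ring_of_type_algebra"

definition monomial :: "('n \<Rightarrow>\<^sub>0 nat) \<Rightarrow> ('n, 'k::field) mpoly" where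
  "monomial a = Poly_Mapping.single a 1"

definition squarefree_monomial :: "('n, 'k::field) mpoly \<Rightarrow> bool" where
  "squarefree_monomial p \<longleftrightarrow> (\<exists>a. p = monomial a \<and> (\<forall>i. Poly_Mapping.lookup a i \<le> 1))"

definition squarefree_monomial_ideal :: "('n, 'k::field) mpoly set \<Rightarrow> bool" where
  "squarefree_monomial_ideal I \<longleftrightarrow>
     (\<exists>G. (\<forall>g\<in>G. squarefree_monomial g) \<and> I = Idl\<^bsub>mpoly_ring\<^esub> G)"

definition subring_in :: "'n set \<Rightarrow> ('n, 'k::field) mpoly set" where
  \<comment> \<open>$K[Z]$\<close>
  "subring_in Z = {p. \<forall>a\<in>Poly_Mapping.keys p. Poly_Mapping.keys a \<subseteq> Z}"

definition mpoly_part :: "('n \<Rightarrow> int) \<Rightarrow> ('n, 'k::field) mpoly set" where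
  \<comment> \<open>The component of degree \<open>d\<close> in the standard $\mathbb{Z}^n$-grading; it is zero unless \<open>d \<ge> 0\<close>.\<close>
  "mpoly_part d = {p. \<forall>a\<in>Poly_Mapping.keys p. \<forall>i. int (Poly_Mapping.lookup a i) = d i}"

record ('n, 'k, 'm) graded_module = "(('n, 'k::field) mpoly, 'm) module" +
  part :: "('n \<Rightarrow> int) \<Rightarrow> 'm set"

text \<open>
  The record type of modules extends that of rings, so a multiplication and a unit have to be
  supplied below; they play no role in the module structure.
\<close>

definition ideal_module ::
  "('n, 'k::field) mpoly set \<Rightarrow> ('n, 'k, ('n, 'k) mpoly) graded_module" where
  "ideal_module I =
     \<lparr>carrier = I, monoid.mult = (*), one = 1, ring.zero = 0, add = (+), module.smult = (*),
      part = (\<lambda>d. I \<inter> mpoly_part d)\<rparr>"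

definition quotient_module ::
  "('n, 'k::field) mpoly set \<Rightarrow> ('n, 'k, ('n, 'k) mpoly set) graded_module" where
  "quotient_module I =
     \<lparr>carrier = carrier (mpoly_ring Quot I), monoid.mult = monoid.mult (mpoly_ring Quot I),
      one = monoid.one (mpoly_ring Quot I), ring.zero = ring.zero (mpoly_ring Quot I),
      add = ring.add (mpoly_ring Quot I),
      module.smult = (\<lambda>p C. (I +>\<^bsub>mpoly_ring\<^esub> p) \<otimes>\<^bsub>mpoly_ring Quot I\<^esub> C),
      part = (\<lambda>d. (\<lambda>p. I +>\<^bsub>mpoly_ring\<^esub> p) ` mpoly_part d)\<rparr>"

definition homogeneous :: "('n, 'k::field, 'm) graded_module \<Rightarrow> 'm \<Rightarrow> bool" where
  "homogeneous M m \<longleftrightarrow> m \<in> carrier M \<and> (\<exists>d. m \<in> part M d)"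

definition cyclic_space ::
  "('n, 'k::field, 'm) graded_module \<Rightarrow> 'm \<Rightarrow> 'n set \<Rightarrow> 'm set" where
  \<comment> \<open>$m K[Z]$\<close>
  "cyclic_space M m Z = (\<lambda>f. f \<odot>\<^bsub>M\<^esub> m) ` subring_in Z"

definition is_basis ::
  "('n, 'k::field, 'm) graded_module \<Rightarrow> 'n set \<Rightarrow> 'm set \<Rightarrow> 'm set \<Rightarrow> bool" where
  \<comment> \<open>\<open>B\<close> is a basis of the $K[Z]$-submodule \<open>N\<close> of \<open>M\<close>: every element of \<open>N\<close> is a unique
     finite $K[Z]$-linear combination of elements of \<open>B\<close>.\<close>
  "is_basis M Z N B \<longleftrightarrow> B \<subseteq> N \<and>
     (\<forall>x\<in>N. \<exists>!c. range c \<subseteq> subring_in Z \<and> finite {b. c b \<noteq> 0} \<and> {b. c b \<noteq> 0} \<subseteq> B \<and>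
        x = (\<Oplus>\<^bsub>M\<^esub>b\<in>{b. c b \<noteq> 0}. c b \<odot>\<^bsub>M\<^esub> b))"

definition stanley_space ::
  "('n, 'k::field, 'm) graded_module \<Rightarrow> 'm \<Rightarrow> 'n set \<Rightarrow> bool" where
  "stanley_space M m Z \<longleftrightarrow> homogeneous M m \<and> (\<exists>B. is_basis M Z (cyclic_space M m Z) B)"

text \<open>
  A decomposition is given by the list of the pairs $(m_j, Z_j)$.  Since every $m_j$ is
  homogeneous, each summand $m_j K[Z_j]$ is a graded subspace, so that an internal direct sum
  of these subspaces is automatically one of graded vector spaces.
\<close>

definition stanley_decomposition ::
  "('n, 'k::field, 'm) graded_module \<Rightarrow> ('m \<times> 'n set) list \<Rightarrow> bool" where
  "stanley_decomposition M D \<longleftrightarrow>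
     (\<forall>(m, Z)\<in>set D. stanley_space M m Z) \<and>
     (\<forall>x\<in>carrier M.
        \<exists>!y. y \<in> (\<Pi>\<^sub>E j\<in>{..<length D}. cyclic_space M (fst (D ! j)) (snd (D ! j))) \<and>
             x = (\<Oplus>\<^bsub>M\<^esub>j\<in>{..<length D}. y j))"

text \<open>
  For a nonzero module every decomposition is nonempty, so the minimum below is meaningful;
  with finitely many variables the maximum ranges over a finite set of numbers.
\<close>

definition sdepth_decomposition :: "('m \<times> 'n set) list \<Rightarrow> nat" where
  "sdepth_decomposition D = Min ((\<lambda>(m, Z). card Z) ` set D)"

definition sdepth :: "('n::finite, 'k::field, 'm) graded_module \<Rightarrow> nat" where
  "sdepth M = Max (sdepth_decomposition ` {D. stanley_decomposition M D})"

end

theory Submission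
  imports Defs
begin

text \<open>
  Both modules have a basis of monomials, and a Stanley decomposition splits the exponents of these
  monomials into boxes $a + \mathbb{N}^Z$.  For squarefree ideals only the squarefree exponents
  matter: a box meets them in an interval $\{A..A \cup Z\}$ of the Boolean lattice (or not at all), and
  conversely the monomials of $x^A K[B]$ with $A \subseteq B$ are exactly those whose support lies in
  $\{A..B\}$.  Hence the Stanley depth is at least $k$ if and only if the family of supports of the
  squarefree monomials can be partitioned into intervals whose tops have at least $k$ elements
  (\<open>le_sdepth_iff\<close>).  For $I$ this family is an up-set $F$ of subsets of a five-element set, for $S/I$ it
  is the simplicial complex $\Delta = - F$, and it remains to turn a partition of $\Delta$ with tops of
  size at least $d$ into a partition of $F$ with tops of size at least $d + 1$
  (\<open>complement_partitionable\<close>).  As $\emptyset \in \Delta$ and the full set is not in $\Delta$, only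
  $d \le 4$ occurs.

  The case $d = 0$ is trivial.  If $d = 1$, some point $j$ is a vertex of $\Delta$, and the singletons
  $\{i\} \in F$ are paired with $\{i, j\}$.  If $d = 4$, all facets of $\Delta$ have four elements, so $F$
  is a single interval.

  If $d = 2$, only the edges of $\Delta$ matter.  When all five points are vertices, the pairs in $F$ can be
  matched injectively with triples containing them.  Otherwise $\Delta$ has at most four vertices, none of them
  isolated, and its graph is connected: two disjoint edges $ab$, $uv$ without further edges would be the only
  possible tops above $\{a\}, \{b\}$ and above $\{u\}, \{v\}$, which would force $\emptyset$ into two intervals
  (\<open>partitionable_unique_tops\<close>).  A spanning tree of that graph tells how to match the pairs in $F$.

  If $d = 3$, all facets of $\Delta$ have at least three elements, so the complements of the members of $F$ are the
  cliques of a graph.  If every nonempty induced subgraph has a simplicial vertex, removing such vertices one by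
  one partitions the cliques into intervals whose bottoms have at most one element; taking complements gives tops
  of size at least four.  A graph on at most five points fails this condition only if it has an induced
  cycle of length four or five.  A four-cycle makes the link of the remaining point in $\Delta$ two disjoint
  edges, which is excluded as above.  For a five-cycle the signed count of the faces of $\Delta$ is
  $1 - 5 + 10 - 5 = 1$, whereas a partition with tops of size three makes it nonpositive.
\<close>

section \<open>Interval partitions of set families\<close>

definition partitionable :: "nat \<Rightarrow> 'a set set \<Rightarrow> bool" where
  "partitionable k G \<longleftrightarrow> (\<exists>P. (\<forall>(A, B)\<in>P. A \<subseteq> B \<and> k \<le> card B) \<and>
     G = (\<Union>(A, B)\<in>P. {A..B}) \<and> disjoint_family_on (\<lambda>(A, B). {A..B}) P)"

lemma partitionable_interval:
  assumes "A \<subseteq> B" "k \<le> card B"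
  shows "partitionable k {A..B}"
  unfolding partitionable_def
  by (rule exI[of _ "{(A, B)}"]) (use assms in \<open>auto simp: disjoint_family_on_def\<close>)

lemma partitionable_mono:
  assumes "partitionable k G" "j \<le> k"
  shows "partitionable j G"
proof -
  obtain P where P: "\<forall>(A, B)\<in>P. A \<subseteq> B \<and> k \<le> card B"
    "G = (\<Union>(A, B)\<in>P. {A..B})" "disjoint_family_on (\<lambda>(A, B). {A..B}) P"
    using assms(1)[unfolded partitionable_def] by (elim exE conjE) (rule that)
  have "\<forall>(A, B)\<in>P. A \<subseteq> B \<and> j \<le> card B" using P(1) assms(2) by fastforce
  then show ?thesis unfolding partitionable_def using P(2,3) by (intro exI[of _ P] conjI)
qed

lemma partitionable_UN:
  assumes part: "\<And>i. i \<in> J \<Longrightarrow> partitionable k (G i)"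
    and disj: "disjoint_family_on G J"
  shows "partitionable k (\<Union>i\<in>J. G i)"
proof -
  have "\<forall>i\<in>J. \<exists>P. (\<forall>(A, B)\<in>P. A \<subseteq> B \<and> k \<le> card B) \<and>
     G i = (\<Union>(A, B)\<in>P. {A..B}) \<and> disjoint_family_on (\<lambda>(A, B). {A..B}) P"
    using part unfolding partitionable_def by blast
  then obtain P where P: "\<forall>i\<in>J. (\<forall>(A, B)\<in>P i. A \<subseteq> B \<and> k \<le> card B) \<and>
     G i = (\<Union>(A, B)\<in>P i. {A..B}) \<and> disjoint_family_on (\<lambda>(A, B). {A..B}) (P i)"
    by (rule bchoice[THEN exE])
  then have P1: "\<And>i A B. i \<in> J \<Longrightarrow> (A, B) \<in> P i \<Longrightarrow> A \<subseteq> B \<and> k \<le> card B"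
    and P2: "\<And>i. i \<in> J \<Longrightarrow> G i = (\<Union>(A, B)\<in>P i. {A..B})"
    and P3: "\<And>i. i \<in> J \<Longrightarrow> disjoint_family_on (\<lambda>(A, B). {A..B}) (P i)"
    by blast+
  have "(\<lambda>(A, B). {A..B}) p \<inter> (\<lambda>(A, B). {A..B}) q = {}"
    if "i \<in> J" "j \<in> J" "p \<in> P i" "q \<in> P j" "p \<noteq> q" for i j p q
  proof (cases "i = j")
    case True
    then show ?thesis
      using P3[of i] that unfolding disjoint_family_on_def by simp
  next
    case False
    have "(\<lambda>(A, B). {A..B}) p \<subseteq> G i" "(\<lambda>(A, B). {A..B}) q \<subseteq> G j"
      using P2[of i] P2[of j] that by blast+
    then show ?thesis
      using disj False that unfolding disjoint_family_on_def by blast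
  qed
  then have "disjoint_family_on (\<lambda>(A, B). {A..B}) (\<Union>i\<in>J. P i)"
    unfolding disjoint_family_on_def by blast
  moreover have "(\<Union>i\<in>J. G i) = (\<Union>(A, B)\<in>(\<Union>i\<in>J. P i). {A..B})"
    using P2 by simp
  moreover have "\<forall>(A, B)\<in>(\<Union>i\<in>J. P i). A \<subseteq> B \<and> k \<le> card B"
    using P1 by blast
  ultimately show ?thesis
    unfolding partitionable_def by blast
qed

lemma partitionable_Un:
  assumes "partitionable k G" "partitionable k Y" "G \<inter> Y = {}"
  shows "partitionable k (G \<union> Y)"
proof -
  have "partitionable k (\<Union>i\<in>{True, False}. if i then G else Y)"
    by (rule partitionable_UN) (use assms in \<open>auto simp: disjoint_family_on_def\<close>)
  then show ?thesis by (simp add: Un_commute)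
qed

lemma partitionable_large:
  assumes "\<And>\<sigma>. \<sigma> \<in> G \<Longrightarrow> k \<le> card \<sigma>"
  shows "partitionable k G"
proof -
  have "partitionable k (\<Union>\<sigma>\<in>G. {\<sigma>..\<sigma>})"
    by (intro partitionable_UN partitionable_interval) (use assms in \<open>auto simp: disjoint_family_on_def\<close>)
  then show ?thesis by simp
qed

text \<open>
  A set of the lowest size $k$ and its partner of size $k + 1$ form a two-element interval, so pairing
  off the lowest level raises the minimal size of a top by one.
\<close>
lemma partitionable_matching:
  fixes G :: "'a::finite set set"
  assumes large: "\<And>\<sigma>. \<sigma> \<in> G \<Longrightarrow> k \<le> card \<sigma>"
    and match: "\<And>\<sigma>. \<sigma> \<in> G \<Longrightarrow> card \<sigma> = k \<Longrightarrow> \<phi> \<sigma> \<in> G \<and> \<sigma> \<subseteq> \<phi> \<sigma> \<and> card (\<phi> \<sigma>) = Suc k"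
    and inj: "inj_on \<phi> {\<sigma> \<in> G. card \<sigma> = k}"
  shows "partitionable (Suc k) G"
proof -
  define L where "L = {\<sigma> \<in> G. card \<sigma> = k}"
  have pair: "{\<sigma>..\<phi> \<sigma>} = {\<sigma>, \<phi> \<sigma>}" if "\<sigma> \<in> L" for \<sigma>
  proof -
    have *: "\<sigma> \<subseteq> \<phi> \<sigma>" "card (\<phi> \<sigma>) = Suc (card \<sigma>)"
      using match that by (auto simp: L_def)
    have "\<tau> = \<sigma> \<or> \<tau> = \<phi> \<sigma>" if "\<sigma> \<subseteq> \<tau>" "\<tau> \<subseteq> \<phi> \<sigma>" for \<tau>
    proof (cases "card \<tau> = card \<sigma>")
      case True
      then show ?thesis using that card_subset_eq[of \<tau> \<sigma>] by simp
    next
      case False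
      then have "card \<tau> = card (\<phi> \<sigma>)"
        using card_mono[of \<tau> \<sigma>] card_mono[of "\<phi> \<sigma>" \<tau>] * that by simp
      then show ?thesis using that card_subset_eq[of "\<phi> \<sigma>" \<tau>] by simp
    qed
    then show ?thesis using *(1) unfolding set_eq_iff atLeastAtMost_iff by blast
  qed
  have lev: "card (\<phi> \<sigma>) = Suc k" "\<phi> \<sigma> \<in> G" "\<sigma> \<subseteq> \<phi> \<sigma>" "card \<sigma> = k" "\<sigma> \<in> G" if "\<sigma> \<in> L" for \<sigma>
    using match that by (auto simp: L_def)
  have disj: "disjoint_family_on (\<lambda>\<sigma>. {\<sigma>..\<phi> \<sigma>}) L"
    unfolding disjoint_family_on_def
  proof (intro ballI impI)
    fix \<sigma> \<tau> assume *: "\<sigma> \<in> L" "\<tau> \<in> L" "\<sigma> \<noteq> \<tau>"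
    then have "\<phi> \<sigma> \<noteq> \<phi> \<tau>"
      using inj by (auto simp: L_def inj_on_def)
    then show "{\<sigma>..\<phi> \<sigma>} \<inter> {\<tau>..\<phi> \<tau>} = {}"
      using * lev[of \<sigma>] lev[of \<tau>] by (auto simp: pair)
  qed
  have "partitionable (Suc k) (\<Union>\<sigma>\<in>L. {\<sigma>..\<phi> \<sigma>})"
    by (rule partitionable_UN[OF _ disj]) (intro partitionable_interval; simp add: lev)
  moreover have "partitionable (Suc k) (G - (\<Union>\<sigma>\<in>L. {\<sigma>..\<phi> \<sigma>}))"
  proof (rule partitionable_large)
    fix \<sigma> assume \<sigma>: "\<sigma> \<in> G - (\<Union>\<sigma>\<in>L. {\<sigma>..\<phi> \<sigma>})"
    then have "\<sigma> \<notin> L" using lev(3)[of \<sigma>] by auto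
    then show "Suc k \<le> card \<sigma>" using \<sigma> large[of \<sigma>] by (auto simp: L_def)
  qed
  moreover have "(\<Union>\<sigma>\<in>L. {\<sigma>..\<phi> \<sigma>}) \<subseteq> G"
    using lev by (auto simp: pair)
  then have "G = (\<Union>\<sigma>\<in>L. {\<sigma>..\<phi> \<sigma>}) \<union> (G - (\<Union>\<sigma>\<in>L. {\<sigma>..\<phi> \<sigma>}))"
    by blast
  ultimately show ?thesis
    using partitionable_Un by (metis Diff_disjoint)
qed

lemma partitionableE:
  assumes "partitionable k G"
  obtains P where "\<And>A B. (A, B) \<in> P \<Longrightarrow> A \<subseteq> B \<and> k \<le> card B \<and> {A..B} \<subseteq> G"
    and "\<And>\<sigma>. \<sigma> \<in> G \<Longrightarrow> \<exists>A B. (A, B) \<in> P \<and> A \<subseteq> \<sigma> \<and> \<sigma> \<subseteq> B"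
    and "\<And>A B A' B' \<sigma>. (A, B) \<in> P \<Longrightarrow> (A', B') \<in> P \<Longrightarrow> A \<subseteq> \<sigma> \<Longrightarrow> \<sigma> \<subseteq> B \<Longrightarrow>
           A' \<subseteq> \<sigma> \<Longrightarrow> \<sigma> \<subseteq> B' \<Longrightarrow> A = A' \<and> B = B'"
proof -
  obtain P where P: "\<forall>(A, B)\<in>P. A \<subseteq> B \<and> k \<le> card B" "G = (\<Union>(A, B)\<in>P. {A..B})"
      "disjoint_family_on (\<lambda>(A, B). {A..B}) P"
    using assms[unfolded partitionable_def] by (elim exE conjE) (rule that)
  show thesis
  proof
    show "A \<subseteq> B \<and> k \<le> card B \<and> {A..B} \<subseteq> G" if "(A, B) \<in> P" for A B
      using P(1) that unfolding P(2) by blast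
    show "\<exists>A B. (A, B) \<in> P \<and> A \<subseteq> \<sigma> \<and> \<sigma> \<subseteq> B" if "\<sigma> \<in> G" for \<sigma>
      using that unfolding P(2) by auto blast
    show "A = A' \<and> B = B'"
      if "(A, B) \<in> P" "(A', B') \<in> P" "A \<subseteq> \<sigma>" "\<sigma> \<subseteq> B" "A' \<subseteq> \<sigma>" "\<sigma> \<subseteq> B'" for A B A' B' \<sigma>
    proof (rule ccontr)
      assume "\<not> (A = A' \<and> B = B')"
      then have "{A..B} \<inter> {A'..B'} = {}"
        using disjoint_family_onD[OF P(3) that(1,2)] by auto
      moreover have "\<sigma> \<in> {A..B} \<inter> {A'..B'}" using that by simp
      ultimately show False by blast
    qed
  qed
qed

lemma partitionable_top:
  assumes "partitionable k G" "\<sigma> \<in> G"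
  obtains B where "B \<in> G" "\<sigma> \<subseteq> B" "k \<le> card B"
proof (rule partitionableE[OF assms(1)])
  fix P
  assume P: "\<And>A B. (A, B) \<in> P \<Longrightarrow> A \<subseteq> B \<and> k \<le> card B \<and> {A..B} \<subseteq> G"
    "\<And>\<sigma>. \<sigma> \<in> G \<Longrightarrow> \<exists>A B. (A, B) \<in> P \<and> A \<subseteq> \<sigma> \<and> \<sigma> \<subseteq> B"
  obtain A B where AB: "(A, B) \<in> P" "A \<subseteq> \<sigma>" "\<sigma> \<subseteq> B" using P(2)[OF assms(2)] by blast
  have "B \<in> G" using P(1)[OF AB(1)] by (meson atLeastAtMost_iff order_refl subsetD)
  then show thesis using that AB P(1) by blast
qed

text \<open>
  If $U$ is the only member of size at least $k$ above $S$ and above $S'$, then both lie in the interval with top $U$,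
  and so does $S \cap S'$.  Applied to $U = \{a, b\}$ and $V = \{c, d\}$ (relative to a common set), this
  says that a link in a partitionable complex cannot consist of two disjoint edges.
\<close>
lemma partitionable_unique_tops:
  assumes part: "partitionable k G"
    and "S \<in> G" "S' \<in> G" "T \<in> G" "T' \<in> G"
    and S: "\<And>B. B \<in> G \<Longrightarrow> k \<le> card B \<Longrightarrow> S \<subseteq> B \<or> S' \<subseteq> B \<Longrightarrow> B = U"
    and T: "\<And>B. B \<in> G \<Longrightarrow> k \<le> card B \<Longrightarrow> T \<subseteq> B \<or> T' \<subseteq> B \<Longrightarrow> B = V"
    and SS: "S \<inter> S' = T \<inter> T'"
  shows "U = V"
proof (rule partitionableE[OF part])
  fix P
  assume P: "\<And>A B. (A, B) \<in> P \<Longrightarrow> A \<subseteq> B \<and> k \<le> card B \<and> {A..B} \<subseteq> G"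
    and cover: "\<And>\<sigma>. \<sigma> \<in> G \<Longrightarrow> \<exists>A B. (A, B) \<in> P \<and> A \<subseteq> \<sigma> \<and> \<sigma> \<subseteq> B"
    and same: "\<And>A B A' B' \<sigma>. (A, B) \<in> P \<Longrightarrow> (A', B') \<in> P \<Longrightarrow> A \<subseteq> \<sigma> \<Longrightarrow> \<sigma> \<subseteq> B \<Longrightarrow>
           A' \<subseteq> \<sigma> \<Longrightarrow> \<sigma> \<subseteq> B' \<Longrightarrow> A = A' \<and> B = B'"
  have key: "\<exists>A. (A, U) \<in> P \<and> A \<subseteq> S \<inter> S' \<and> S \<inter> S' \<subseteq> U"
    if S: "S \<in> G" "S' \<in> G" "\<And>B. B \<in> G \<Longrightarrow> k \<le> card B \<Longrightarrow> S \<subseteq> B \<or> S' \<subseteq> B \<Longrightarrow> B = U" for S S' U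
  proof -
    have top: "\<exists>A. (A, U) \<in> P \<and> A \<subseteq> R \<and> R \<subseteq> U" if R: "R \<in> G" "R = S \<or> R = S'" for R
    proof -
      obtain A B where AB: "(A, B) \<in> P" "A \<subseteq> R" "R \<subseteq> B"
        using cover[OF R(1)] by blast
      have "B \<in> G" using P[OF AB(1)] by (meson atLeastAtMost_iff order_refl subsetD)
      then have "B = U" using S(3)[of B] P[OF AB(1)] R(2) AB(3) by blast
      then show ?thesis using AB by blast
    qed
    obtain A where A: "(A, U) \<in> P" "A \<subseteq> S" "S \<subseteq> U" using top[OF S(1)] by blast
    obtain A' where A': "(A', U) \<in> P" "A' \<subseteq> S'" "S' \<subseteq> U" using top[OF S(2)] by blast
    have "A = A'"
      using same[OF A(1) A'(1), of U] A A' by blast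
    then show ?thesis using A A' by blast
  qed
  obtain A where A: "(A, U) \<in> P" "A \<subseteq> S \<inter> S'" "S \<inter> S' \<subseteq> U"
    using key[OF assms(2,3) S] by blast
  obtain A' where A': "(A', V) \<in> P" "A' \<subseteq> T \<inter> T'" "T \<inter> T' \<subseteq> V"
    using key[OF assms(4,5) T] by blast
  show "U = V"
    using same[OF A(1) A'(1) A(2,3)] A'(2,3) SS by simp
qed

section \<open>Up-sets and their complements: depth one and corank one\<close>

definition up_closed :: "'a set set \<Rightarrow> bool" where
  "up_closed F \<longleftrightarrow> (\<forall>\<sigma>\<in>F. \<forall>\<tau>. \<sigma> \<subseteq> \<tau> \<longrightarrow> \<tau> \<in> F)"

lemma up_closedD: "up_closed F \<Longrightarrow> \<sigma> \<in> F \<Longrightarrow> \<sigma> \<subseteq> \<tau> \<Longrightarrow> \<tau> \<in> F"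
  by (auto simp: up_closed_def)

text \<open>
  The interval that contains $\emptyset$ has a nonempty top, which provides a point $j$ with $\{j\} \notin F$.
\<close>
lemma complement_partitionable_1:
  fixes F :: "'a::finite set set"
  assumes upset: "up_closed F"
    and "{} \<notin> F" and part: "partitionable 1 (- F)"
  shows "partitionable 2 F"
proof -
  note up = up_closedD[OF upset]
  obtain B where B: "B \<notin> F" "1 \<le> card B"
    using partitionable_top[OF part, of "{}"] assms(2) by auto
  then obtain j where "j \<in> B" by fastforce
  then have j: "j \<notin> \<sigma>" if "\<sigma> \<in> F" "card \<sigma> = 1" for \<sigma>
    using that up[of \<sigma> B] B by (auto simp: card_1_singleton_iff)
  have "partitionable (Suc 1) F"
  proof (rule partitionable_matching)
    show "1 \<le> card \<sigma>" if "\<sigma> \<in> F" for \<sigma>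
      using that assms(2) by (auto simp: Suc_le_eq card_gt_0_iff)
    show "insert j \<sigma> \<in> F \<and> \<sigma> \<subseteq> insert j \<sigma> \<and> card (insert j \<sigma>) = Suc 1"
      if "\<sigma> \<in> F" "card \<sigma> = 1" for \<sigma>
      using that j up[of \<sigma> "insert j \<sigma>"] by auto
    show "inj_on (insert j) {\<sigma> \<in> F. card \<sigma> = 1}"
      using j by (fastforce simp: inj_on_def)
  qed
  then show ?thesis by (simp add: numeral_2_eq_2)
qed

text \<open>
  Every set outside $F$ is contained in the complement of a point $i$ with $- \{i\} \notin F$, so
  membership in $F$ means containing all these points.
\<close>
lemma complement_partitionable_corank_1:
  fixes F :: "'a::finite set set"
  assumes upset: "up_closed F"
    and "F \<noteq> {}" and part: "partitionable (CARD('a) - 1) (- F)"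
  shows "partitionable (CARD('a)) F"
proof -
  note up = up_closedD[OF upset]
  have U: "UNIV \<in> F" using assms(2) up[OF _ subset_UNIV] by auto
  define A where "A = {i. - {i} \<notin> F}"
  have "\<sigma> \<in> F \<longleftrightarrow> A \<subseteq> \<sigma>" for \<sigma>
  proof
    assume "\<sigma> \<in> F"
    then show "A \<subseteq> \<sigma>" using up[of \<sigma> "- {i}" for i] by (auto simp: A_def)
  next
    assume A: "A \<subseteq> \<sigma>"
    show "\<sigma> \<in> F"
    proof (rule ccontr)
      assume "\<sigma> \<notin> F"
      then obtain B where B: "B \<notin> F" "\<sigma> \<subseteq> B" "CARD('a) - 1 \<le> card B"
        using partitionable_top[OF part, of \<sigma>] by auto
      then have "B \<noteq> UNIV" using U by auto
      then obtain i where i: "i \<notin> B" by auto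
      then have "B = - {i}"
        using B(3) by (intro card_seteq) (auto simp: Compl_eq_Diff_UNIV card_Diff_singleton)
      then show False using B A i unfolding A_def by auto
    qed
  qed
  then have "F = {A..UNIV}" by auto
  then show ?thesis using partitionable_interval[of A UNIV "CARD('a)"] by simp
qed

section \<open>Depth two\<close>

lemma mod5_cases: "(x::5) = 0 \<or> x = 1 \<or> x = 2 \<or> x = 3 \<or> x = 4"
proof (cases x)
  case (of_int z)
  then have "z = 0 \<or> z = 1 \<or> z = 2 \<or> z = 3 \<or> z = 4" by auto
  then show ?thesis using of_int by auto
qed

text \<open>
  The type of indices is $\mathbb{Z}/5$, where every pair $\{p, q\}$ has the midpoint $(p + q)/2 = 3 (p + q)$.
  Adding the midpoint is injective on pairs: the midpoint is twice the sum of the resulting triple,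
  because $p + q + 3 (p + q) = - (p + q)$.
\<close>
lemma complement_partitionable_2_vertex_free:
  fixes F :: "5 set set"
  assumes upset: "up_closed F"
    and large: "\<And>\<sigma>. \<sigma> \<in> F \<Longrightarrow> 2 \<le> card \<sigma>"
  shows "partitionable 3 F"
proof -
  note up = up_closedD[OF upset]
  define \<phi> where "\<phi> \<sigma> = insert (3 * \<Sum>\<sigma>) \<sigma>" for \<sigma> :: "5 set"
  have pair: "card (\<phi> \<sigma>) = 3 \<and> \<phi> \<sigma> - {2 * \<Sum>(\<phi> \<sigma>)} = \<sigma>" if pq: "card \<sigma> = 2" for \<sigma>
  proof -
    obtain p q where \<sigma>: "\<sigma> = {p, q}" "p \<noteq> q" using pq by (auto simp: card_2_iff)
    have m: "3 * (p + q) \<noteq> p \<and> 3 * (p + q) \<noteq> q"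
      using mod5_cases[of p] mod5_cases[of q] \<sigma>(2) by auto
    have "2 * (3 * (p + q) + (p + q)) = 3 * (p + q)"
      using mod5_cases[of p] mod5_cases[of q] by auto
    moreover have \<phi>: "\<phi> \<sigma> = {3 * (p + q), p, q}"
      using \<sigma> by (simp add: \<phi>_def)
    moreover have "\<Sum>(\<phi> \<sigma>) = 3 * (p + q) + (p + q)"
      unfolding \<phi> using m \<sigma>(2) by (simp del: distrib_left_numeral)
    ultimately have mid: "2 * \<Sum>(\<phi> \<sigma>) = 3 * (p + q)" by presburger
    have "\<phi> \<sigma> - {3 * (p + q)} = {p, q}" using m unfolding \<phi> by blast
    then have "\<phi> \<sigma> - {2 * \<Sum>(\<phi> \<sigma>)} = {p, q}" unfolding mid .
    moreover have "card (\<phi> \<sigma>) = 3" using m \<sigma> unfolding \<phi> by simp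
    ultimately show ?thesis using \<sigma> by simp
  qed
  have "partitionable (Suc 2) F"
  proof (rule partitionable_matching[OF large])
    show "\<phi> \<sigma> \<in> F \<and> \<sigma> \<subseteq> \<phi> \<sigma> \<and> card (\<phi> \<sigma>) = Suc 2" if "\<sigma> \<in> F" "card \<sigma> = 2" for \<sigma>
      using up[OF that(1), of "\<phi> \<sigma>"] pair[OF that(2)] by (auto simp: \<phi>_def)
    show "inj_on \<phi> {\<sigma> \<in> F. card \<sigma> = 2}"
      using pair by (intro inj_on_inverseI[where g = "\<lambda>\<tau>. \<tau> - {2 * \<Sum>\<tau>}"]) simp
  qed
  then show ?thesis by simp
qed

text \<open>
  Let $V$ be the vertex set of $\Delta = - F$.  For each $w \notin V$ the interval from $\{w\}$ to
  $\{w, a, b\}$ is removed, where $ab$ is a fixed edge of $\Delta$.  The remaining pairs are matched with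
  triples: $\{w, v\}$ receives the other end of an edge $\{v, t\,v\}$ that leads from $v$
  towards $ab$, a pair inside $V$ receives the fixed point $w_0 \notin V$, and a pair outside $V$ receives $a$.
  Triples of the last kind are recognised by their two points outside $V$; the other two kinds differ in
  whether their pair inside $V$ is an edge of $\Delta$.
\<close>
lemma complement_partitionable_2:
  fixes F :: "5 set set"
  assumes upset: "up_closed F"
    and "{} \<notin> F" and part: "partitionable 2 (- F)"
  shows "partitionable 3 F"
proof (cases "\<exists>w. {w} \<in> F")
  case False
  have large: "2 \<le> card \<sigma>" if "\<sigma> \<in> F" for \<sigma>
  proof -
    have "card \<sigma> \<noteq> 0" "card \<sigma> \<noteq> 1"
      using that False \<open>{} \<notin> F\<close> by (auto simp: card_1_singleton_iff)
    then show ?thesis by arith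
  qed
  show ?thesis by (rule complement_partitionable_2_vertex_free) (fact upset, fact large)
next
  note up = up_closedD[OF upset]
  case True
  then obtain w\<^sub>0 where w0: "{w\<^sub>0} \<in> F" by blast
  define V where "V = {v. {v} \<notin> F}"
  have sub: "\<sigma> \<subseteq> V" if "\<sigma> \<notin> F" for \<sigma>
    using that up[of "{v}" \<sigma> for v] by (auto simp: V_def)
  have edge: "\<exists>b\<in>V. b \<noteq> v \<and> {v, b} \<notin> F" if "v \<in> V" for v
  proof -
    have "{v} \<in> - F" using that by (simp add: V_def)
    from part this obtain B where B: "B \<in> - F" "{v} \<subseteq> B" "2 \<le> card B"
      by (rule partitionable_top)
    have "\<not> B \<subseteq> {v}" using B(3) card_mono[of "{v}" B] by auto
    then obtain b where "b \<in> B" "b \<noteq> v" by blast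
    moreover then have "{v, b} \<notin> F" using B up[of "{v, b}" B] by blast
    ultimately show ?thesis using sub by blast
  qed
  have "V \<noteq> {}"
  proof -
    have "{} \<in> - F" using \<open>{} \<notin> F\<close> by simp
    from part this obtain B where B: "B \<in> - F" "{} \<subseteq> B" "2 \<le> card B"
      by (rule partitionable_top)
    then show ?thesis using sub by fastforce
  qed
  then obtain a b where ab: "a \<in> V" "b \<in> V" "a \<noteq> b" "{a, b} \<notin> F" using edge by blast
  \<comment> \<open>Preferring neighbours in $\{a, b\}$ makes $t$ point towards the edge $ab$ whenever that is possible.\<close>
  define t where "t v = (if {v, a} \<notin> F then a else if {v, b} \<notin> F then b
    else SOME u. u \<in> V \<and> u \<noteq> v \<and> {v, u} \<notin> F)" for v
  have t: "t v \<in> V \<and> t v \<noteq> v \<and> {v, t v} \<notin> F" if v: "v \<in> V" "v \<noteq> a" "v \<noteq> b" for v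
  proof -
    have "\<exists>u. u \<in> V \<and> u \<noteq> v \<and> {v, u} \<notin> F" using edge[OF v(1)] by blast
    from someI_ex[OF this] show ?thesis using v ab by (simp add: t_def)
  qed
  \<comment> \<open>Distinct $v$ thus give distinct edges $\{v, t\,v\}$: if two points chose each other, $ab$ and $uv$ would be separate components.\<close>
  have mutual: False
    if uv: "u \<in> V - {a, b}" "v \<in> V - {a, b}" "t u = v" "t v = u" for u v
  proof -
    have "u \<noteq> v" using t[of u] uv by auto
    have sep: "{x, y} \<in> F" if "x \<in> {u, v}" "y \<in> {a, b}" for x y
      using uv that unfolding t_def by (auto split: if_splits)
    have "V = {a, b, u, v}"
    proof (rule sym, rule card_seteq)
      have "V \<subset> UNIV" using w0 V_def by auto
      then have "card V < CARD(5)" by (intro psubset_card_mono) auto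
      moreover have "a \<noteq> u" "a \<noteq> v" "b \<noteq> u" "b \<noteq> v" using uv by auto
      then have "card {a, b, u, v} = 4" using ab \<open>u \<noteq> v\<close> by simp
      ultimately show "card V \<le> card {a, b, u, v}" by simp
    qed (use uv ab in auto)
    then have V: "B \<subseteq> {a, b, u, v}" if "B \<in> - F" for B using sub[of B] that by blast
    have sepB: "\<not> (x \<in> B \<and> y \<in> B)" if "B \<in> - F" "x \<in> {u, v}" "y \<in> {a, b}" for B x y
      using sep[OF that(2,3)] up[of "{x, y}" B] that(1) by blast
    have two: "B = S" if "B \<subseteq> S" "2 \<le> card B" "card S = 2" for B S :: "5 set"
      using that by (intro card_seteq) (auto intro: finite_subset)
    have "{a, b} = {u, v}"
    proof (rule partitionable_unique_tops[OF part, of "{a}" "{b}" "{u}" "{v}"])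
      show "{a} \<in> - F" "{b} \<in> - F" "{u} \<in> - F" "{v} \<in> - F"
        using ab uv by (auto simp: V_def)
      show "B = {a, b}" if "B \<in> - F" "2 \<le> card B" "{a} \<subseteq> B \<or> {b} \<subseteq> B" for B
      proof (rule two[OF _ that(2)])
        show "B \<subseteq> {a, b}" using V[OF that(1)] sepB[OF that(1)] that(3) by auto
      qed (use ab in simp)
      show "B = {u, v}" if "B \<in> - F" "2 \<le> card B" "{u} \<subseteq> B \<or> {v} \<subseteq> B" for B
      proof (rule two[OF _ that(2)])
        show "B \<subseteq> {u, v}" using V[OF that(1)] sepB[OF that(1)] that(3) by auto
      qed (use \<open>u \<noteq> v\<close> in simp)
      show "{a} \<inter> {b} = {u} \<inter> {v}" using ab \<open>u \<noteq> v\<close> by simp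
    qed
    then show False using uv ab by (auto simp: doubleton_eq_iff)
  qed
  define G\<^sub>1 where "G\<^sub>1 = (\<Union>w\<in>- V. {{w}..{w, a, b}})"
  have G1V: "\<exists>w. w \<notin> V \<and> \<sigma> - V = {w} \<and> \<sigma> \<inter> V \<subseteq> {a, b}" if "\<sigma> \<in> G\<^sub>1" for \<sigma>
  proof -
    obtain w where "w \<notin> V" "w \<in> \<sigma>" "\<sigma> \<subseteq> {w, a, b}" using \<open>\<sigma> \<in> G\<^sub>1\<close> by (auto simp: G\<^sub>1_def)
    then show ?thesis using ab by (intro exI[of _ w]) auto
  qed
  have G1I: "\<sigma> \<in> G\<^sub>1" if "w \<notin> V" "w \<in> \<sigma>" "\<sigma> \<subseteq> {w, a, b}" for \<sigma> w
    using that by (auto simp: G\<^sub>1_def)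
  have G1F: "G\<^sub>1 \<subseteq> F"
  proof
    fix \<sigma> assume "\<sigma> \<in> G\<^sub>1"
    then obtain w where "w \<notin> V" "w \<in> \<sigma>" by (auto simp: G\<^sub>1_def)
    then show "\<sigma> \<in> F" using up[of "{w}" \<sigma>] by (simp add: V_def)
  qed
  have part1: "partitionable 3 G\<^sub>1"
    unfolding G\<^sub>1_def
  proof (rule partitionable_UN)
    show "partitionable 3 {{w}..{w, a, b}}" if "w \<in> - V" for w
    proof (rule partitionable_interval)
      have "w \<noteq> a" "w \<noteq> b" using that ab by auto
      then show "3 \<le> card {w, a, b}" using ab by simp
    qed simp
    show "disjoint_family_on (\<lambda>w. {{w}..{w, a, b}}) (- V)"
      unfolding disjoint_family_on_def using ab by auto
  qed
  define \<phi> where "\<phi> \<sigma> = (if \<sigma> \<subseteq> - V then insert a \<sigma> else if \<sigma> \<subseteq> V then insert w\<^sub>0 \<sigma>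
    else \<sigma> \<union> t ` (\<sigma> \<inter> V))" for \<sigma>
  have w0V: "w\<^sub>0 \<notin> V" using w0 by (simp add: V_def)
  have kinds: "(\<sigma> \<subseteq> - V \<and> \<phi> \<sigma> - V = \<sigma> \<and> \<phi> \<sigma> \<inter> V = {a}) \<or>
      (\<sigma> \<subseteq> V \<and> \<phi> \<sigma> - V = {w\<^sub>0} \<and> \<phi> \<sigma> \<inter> V = \<sigma>) \<or>
      (\<exists>w v. w \<notin> V \<and> v \<in> V \<and> v \<noteq> a \<and> v \<noteq> b \<and> \<sigma> = {w, v} \<and> \<phi> \<sigma> - V = {w} \<and> \<phi> \<sigma> \<inter> V = {v, t v})"
    if \<sigma>: "\<sigma> \<in> F - G\<^sub>1" "card \<sigma> = 2" for \<sigma>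
  proof -
    consider "\<sigma> \<subseteq> - V" | "\<sigma> \<subseteq> V" | w v where "w \<in> \<sigma>" "w \<notin> V" "v \<in> \<sigma>" "v \<in> V" by auto
    then show ?thesis
    proof cases
      case 1
      then show ?thesis using ab by (auto simp: \<phi>_def)
    next
      case 2
      then have "\<not> \<sigma> \<subseteq> - V" using \<sigma>(2) by (cases "\<sigma> = {}") auto
      then show ?thesis using 2 w0V by (auto simp: \<phi>_def)
    next
      case 3
      then have wv: "\<sigma> = {w, v}"
        using \<sigma>(2) by (auto simp: card_2_iff)
      then have "v \<noteq> a" "v \<noteq> b" using G1I[of w \<sigma>] 3 \<sigma>(1) by auto
      then have "\<phi> \<sigma> - V = {w} \<and> \<phi> \<sigma> \<inter> V = {v, t v}"
        using wv 3 t[of v] by (auto simp: \<phi>_def)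
      then have "w \<notin> V \<and> v \<in> V \<and> v \<noteq> a \<and> v \<noteq> b \<and> \<sigma> = {w, v} \<and> \<phi> \<sigma> - V = {w} \<and> \<phi> \<sigma> \<inter> V = {v, t v}"
        using 3(2,4) \<open>v \<noteq> a\<close> \<open>v \<noteq> b\<close> wv by (intro conjI) (assumption | erule conjunct1 conjunct2)+
      then show ?thesis by (intro disjI2 exI)
    qed
  qed
  have split: "card \<tau> = card (\<tau> - V) + card (\<tau> \<inter> V)" for \<tau>
    by (subst card_Un_disjoint[symmetric]) (auto simp: Diff_Int2 intro!: arg_cong[of _ _ card])
  have "partitionable (Suc 2) (F - G\<^sub>1)"
  proof (rule partitionable_matching)
    fix \<sigma> assume \<sigma>: "\<sigma> \<in> F - G\<^sub>1"
    have "card \<sigma> \<noteq> 0" using \<sigma> \<open>{} \<notin> F\<close> by auto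
    moreover have "card \<sigma> \<noteq> 1"
    proof
      assume "card \<sigma> = 1"
      then obtain w where "\<sigma> = {w}" by (auto simp: card_1_singleton_iff)
      then show False using \<sigma> G1I[of w \<sigma>] by (auto simp: V_def)
    qed
    ultimately show "2 \<le> card \<sigma>" by arith
    assume card: "card \<sigma> = 2"
    have "\<sigma> \<subseteq> \<phi> \<sigma>" by (auto simp: \<phi>_def)
    moreover have "\<phi> \<sigma> \<in> F" using \<sigma> up[of \<sigma>, OF _ \<open>\<sigma> \<subseteq> \<phi> \<sigma>\<close>] by blast
    moreover have "card (\<phi> \<sigma>) = 3 \<and> \<phi> \<sigma> \<notin> G\<^sub>1"
      using kinds[OF \<sigma> card]
    proof (elim disjE exE conjE)
      assume *: "\<phi> \<sigma> - V = \<sigma>" "\<phi> \<sigma> \<inter> V = {a}"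
      then have "\<phi> \<sigma> \<notin> G\<^sub>1" using G1V[of "\<phi> \<sigma>"] card by (auto simp: card_2_iff)
      then show ?thesis using split[of "\<phi> \<sigma>"] * card by simp
    next
      assume *: "\<phi> \<sigma> - V = {w\<^sub>0}" "\<phi> \<sigma> \<inter> V = \<sigma>"
      have "\<not> \<sigma> \<subseteq> {a, b}" using ab \<sigma> up[of \<sigma> "{a, b}"] by auto
      then have "\<phi> \<sigma> \<notin> G\<^sub>1" using G1V[of "\<phi> \<sigma>"] * by auto
      then show ?thesis using split[of "\<phi> \<sigma>"] * card by simp
    next
      fix w v assume *: "v \<in> V" "v \<noteq> a" "v \<noteq> b" "\<phi> \<sigma> - V = {w}" "\<phi> \<sigma> \<inter> V = {v, t v}"
      then have "\<phi> \<sigma> \<notin> G\<^sub>1" using G1V[of "\<phi> \<sigma>"] by auto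
      moreover have "t v \<noteq> v" using t[of v] *(1-3) by simp
      then have "card (\<phi> \<sigma>) = 3" using split[of "\<phi> \<sigma>"] unfolding *(4,5) by simp
      ultimately show ?thesis by simp
    qed
    ultimately show "\<phi> \<sigma> \<in> F - G\<^sub>1 \<and> \<sigma> \<subseteq> \<phi> \<sigma> \<and> card (\<phi> \<sigma>) = Suc 2" by simp
  next
    \<comment> \<open>The inverse of $\varphi$: it recognises the three kinds of triples by their parts outside and inside $V$.\<close>
    define \<psi> where "\<psi> \<rho> = (if card (\<rho> - V) = 2 then \<rho> - V else if \<rho> \<inter> V \<in> F then \<rho> \<inter> V
      else (\<rho> - V) \<union> {v \<in> V - {a, b}. \<rho> \<inter> V = {v, t v}})" for \<rho>
    show "inj_on \<phi> {\<sigma> \<in> F - G\<^sub>1. card \<sigma> = 2}"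
    proof (rule inj_on_inverseI[where g = \<psi>])
      fix \<sigma> assume "\<sigma> \<in> {\<sigma> \<in> F - G\<^sub>1. card \<sigma> = 2}"
      then have \<sigma>: "\<sigma> \<in> F - G\<^sub>1" "card \<sigma> = 2" by auto
      from kinds[OF \<sigma>] show "\<psi> (\<phi> \<sigma>) = \<sigma>"
      proof (elim disjE exE conjE)
        assume "\<phi> \<sigma> - V = \<sigma>"
        then show ?thesis using \<sigma>(2) by (simp add: \<psi>_def)
      next
        assume "\<phi> \<sigma> - V = {w\<^sub>0}" "\<phi> \<sigma> \<inter> V = \<sigma>"
        then show ?thesis using \<sigma>(1) by (simp add: \<psi>_def)
      next
        fix w v
        assume v: "v \<in> V" "v \<noteq> a" "v \<noteq> b" and wv: "\<sigma> = {w, v}"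
          and \<phi>: "\<phi> \<sigma> - V = {w}" "\<phi> \<sigma> \<inter> V = {v, t v}"
        have "v = v'" if "v' \<in> V - {a, b}" "{v, t v} = {v', t v'}" for v'
          using that mutual[of v v'] v by (auto simp: doubleton_eq_iff)
        then have "{v' \<in> V - {a, b}. {v, t v} = {v', t v'}} = {v}" using v by blast
        moreover have "{v, t v} \<notin> F" using t[of v] v by simp
        ultimately have "\<psi> (\<phi> \<sigma>) = {w} \<union> {v}" unfolding \<psi>_def \<phi> by simp
        then show ?thesis by (simp add: wv insert_commute)
      qed
    qed
  qed
  then have "partitionable 3 (G\<^sub>1 \<union> (F - G\<^sub>1))"
    using part1 by (intro partitionable_Un) auto
  then show ?thesis using G1F by (simp add: Un_absorb1)
qed

section \<open>Depth three\<close>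

text \<open>
  For a simplicial vertex $v$ with closed neighbourhood $N$, the cliques containing $v$ are exactly the
  sets between $\{v\}$ and $N$.  The statement is about complements of cliques, since these
  form the family that has to be partitioned; the bottoms $\{v\}$ become tops of corank one.
\<close>
lemma partitionable_co_cliques:
  fixes adj :: "'a::finite \<Rightarrow> 'a \<Rightarrow> bool"
  assumes loops: "\<And>v. v \<in> Y \<Longrightarrow> adj v v"
    and simplicial: "\<And>Z. Z \<subseteq> Y \<Longrightarrow> Z \<noteq> {} \<Longrightarrow>
      \<exists>v\<in>Z. \<forall>x\<in>Z. \<forall>y\<in>Z. adj v x \<longrightarrow> adj v y \<longrightarrow> adj x y"
  shows "partitionable (CARD('a) - 1) {\<sigma>. - \<sigma> \<subseteq> Y \<and> (\<forall>x\<in>- \<sigma>. \<forall>y\<in>- \<sigma>. adj x y)}"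
proof -
  have "partitionable (CARD('a) - 1) {\<sigma>. - \<sigma> \<subseteq> Z \<and> (\<forall>x\<in>- \<sigma>. \<forall>y\<in>- \<sigma>. adj x y)}" if "Z \<subseteq> Y" for Z
    using that
  proof (induction "card Z" arbitrary: Z)
    case 0
    then have "Z = {}" by simp
    then have "{\<sigma>. - \<sigma> \<subseteq> Z \<and> (\<forall>x\<in>- \<sigma>. \<forall>y\<in>- \<sigma>. adj x y)} = {UNIV..UNIV}" by auto
    then show ?case using partitionable_interval[of UNIV "UNIV :: 'a set" "CARD('a) - 1"] by simp
  next
    case (Suc n)
    then have "Z \<noteq> {}" by auto
    then obtain v where v: "v \<in> Z" and simp: "\<forall>x\<in>Z. \<forall>y\<in>Z. adj v x \<longrightarrow> adj v y \<longrightarrow> adj x y"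
      using simplicial[OF Suc.prems] by blast
    have "adj v v" using v Suc.prems loops by blast
    define N where "N = {x \<in> Z. adj v x}"
    let ?K = "\<lambda>Z. {\<sigma>. - \<sigma> \<subseteq> Z \<and> (\<forall>x\<in>- \<sigma>. \<forall>y\<in>- \<sigma>. adj x y)}"
    have "partitionable (CARD('a) - 1) (?K (Z - {v}))"
      by (rule Suc.hyps(1)) (use Suc v in auto)
    moreover have "partitionable (CARD('a) - 1) {- N..- {v}}"
    proof (rule partitionable_interval)
      show "- N \<subseteq> - {v}" using v \<open>adj v v\<close> by (simp add: N_def)
      show "CARD('a) - 1 \<le> card (- {v})" by (simp add: Compl_eq_Diff_UNIV card_Diff_singleton)
    qed
    moreover have "?K (Z - {v}) \<inter> {- N..- {v}} = {}" by auto
    moreover have "?K (Z - {v}) \<union> {- N..- {v}} = ?K Z"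
    proof (rule Set.set_eqI)
      fix \<sigma>
      show "\<sigma> \<in> ?K (Z - {v}) \<union> {- N..- {v}} \<longleftrightarrow> \<sigma> \<in> ?K Z"
      proof (cases "v \<in> \<sigma>")
        case True
        then show ?thesis by auto
      next
        case False
        have "- N \<subseteq> \<sigma> \<longleftrightarrow> - \<sigma> \<subseteq> Z \<and> (\<forall>x\<in>- \<sigma>. \<forall>y\<in>- \<sigma>. adj x y)"
        proof
          assume "- N \<subseteq> \<sigma>"
          then have "- \<sigma> \<subseteq> N" by blast
          then show "- \<sigma> \<subseteq> Z \<and> (\<forall>x\<in>- \<sigma>. \<forall>y\<in>- \<sigma>. adj x y)"
            using simp unfolding N_def by blast
        next
          assume "- \<sigma> \<subseteq> Z \<and> (\<forall>x\<in>- \<sigma>. \<forall>y\<in>- \<sigma>. adj x y)"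
          then have "- \<sigma> \<subseteq> N" using False unfolding N_def by blast
          then show "- N \<subseteq> \<sigma>" by blast
        qed
        then show ?thesis using False by auto
      qed
    qed
    ultimately show ?case using partitionable_Un[of _ "?K (Z - {v})" "{- N..- {v}}"] by simp
  qed
  then show ?thesis by blast
qed

lemma all_5: "(\<forall>x::5. P x) \<longleftrightarrow> P 0 \<and> P 1 \<and> P 2 \<and> P 3 \<and> P 4"
  using mod5_cases by metis
lemma ex_5: "(\<exists>x::5. P x) \<longleftrightarrow> P 0 \<or> P 1 \<or> P 2 \<or> P 3 \<or> P 4"
  using mod5_cases by metis

text \<open>
  On five points a graph without induced cycles of length four and five is chordal, and chordal graphs have
  simplicial vertices.  With so few points the claim is propositional in the ten possible
  edges: each of the $15$ four-cycles and $12$ five-cycles contributes one clause.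
\<close>
lemma simplicial_vertex_5:
  fixes R :: "5 \<Rightarrow> 5 \<Rightarrow> bool"
  assumes sym: "\<And>x y. R x y \<Longrightarrow> R y x"
    and irr: "\<And>x. \<not> R x x"
    and C4: "\<And>a b c d. a \<noteq> c \<Longrightarrow> b \<noteq> d \<Longrightarrow> R a b \<Longrightarrow> R b c \<Longrightarrow> R c d \<Longrightarrow> R d a \<Longrightarrow> R a c \<or> R b d"
    and C5: "\<And>a b c d e. distinct [a, b, c, d, e] \<Longrightarrow> R a b \<Longrightarrow> R b c \<Longrightarrow> R c d \<Longrightarrow> R d e \<Longrightarrow> R e a \<Longrightarrow>
      R a c \<or> R b d \<or> R c e \<or> R d a \<or> R e b"
    and "R u w"
  shows "\<exists>v x. R v x \<and> (\<forall>y z. R v y \<longrightarrow> R v z \<longrightarrow> y \<noteq> z \<longrightarrow> R y z)"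
proof (rule ccontr)
  assume "\<not> ?thesis"
  then have ns: "\<forall>v. (\<exists>x. R v x) \<longrightarrow> (\<exists>y z. R v y \<and> R v z \<and> y \<noteq> z \<and> \<not> R y z)" by blast
  have ex: "\<exists>u w. R u w" using \<open>R u w\<close> by blast
  \<comment> \<open>These equations leave one atom for each unordered pair of points.\<close>
  have s: "R 1 0 = R 0 1" "R 2 0 = R 0 2" "R 3 0 = R 0 3" "R 4 0 = R 0 4"
      "R 2 1 = R 1 2" "R 3 1 = R 1 3" "R 4 1 = R 1 4" "R 3 2 = R 2 3" "R 4 2 = R 2 4" "R 4 3 = R 3 4"
    using sym by blast+
  note c5 = C5[of 0 1 2 3 4] C5[of 0 1 2 4 3] C5[of 0 1 3 2 4] C5[of 0 1 3 4 2] C5[of 0 1 4 2 3]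
    C5[of 0 1 4 3 2] C5[of 0 2 1 3 4] C5[of 0 2 1 4 3] C5[of 0 2 3 1 4] C5[of 0 2 4 1 3]
    C5[of 0 3 1 2 4] C5[of 0 3 2 1 4]
  note c4 = C4[of 0 1 2 3] C4[of 0 2 1 3] C4[of 0 3 1 2]
    C4[of 0 1 2 4] C4[of 0 2 1 4] C4[of 0 4 1 2]
    C4[of 0 1 3 4] C4[of 0 3 1 4] C4[of 0 4 1 3]
    C4[of 0 2 3 4] C4[of 0 3 2 4] C4[of 0 4 2 3]
    C4[of 1 2 3 4] C4[of 1 3 2 4] C4[of 1 4 2 3]
  show False
    using ns[unfolded all_5 ex_5] ex[unfolded ex_5] c4 c5
    by (simp add: s irr) argo
qed

lemma large_subset_5:
  fixes B :: "5 set"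
  assumes "3 \<le> card B" "B \<noteq> UNIV"
  obtains x y where "x \<notin> B" "y \<notin> B" "B = - {x, y}"
proof -
  have "card (- B) = 5 - card B" by (simp add: Compl_eq_Diff_UNIV card_Diff_subset)
  then have "card (- B) \<le> 2" using assms(1) by simp
  obtain x where x: "x \<notin> B" using assms(2) by blast
  have "\<exists>y. y \<notin> B \<and> - B = {x, y}"
  proof (cases "- B = {x}")
    case True
    then show ?thesis using x by auto
  next
    case False
    then obtain y where y: "y \<notin> B" "y \<noteq> x" using x by blast
    have "{x, y} = - B"
      by (rule card_seteq) (use x y \<open>card (- B) \<le> 2\<close> in auto)
    then show ?thesis using y by auto
  qed
  then show thesis using that[OF x] by (metis double_compl)
qed

text \<open>
  Let $e$ be the fifth point.  The triples outside $F$ that contain $e$ are the complements of the non-adjacent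
  pairs avoiding $e$.  If neither diagonal were an edge, these would be $- \{a, c\}$ and $- \{b, d\}$ only, and the
  link of $e$ would consist of two disjoint edges.
\<close>
lemma no_induced_4_cycle:
  fixes adj :: "5 \<Rightarrow> 5 \<Rightarrow> bool"
  assumes upset: "up_closed F"
    and "UNIV \<in> F" and part: "partitionable 3 (- F)"
    and adj: "\<And>x y. adj x y \<longleftrightarrow> - {x, y} \<in> F"
    and dist: "a \<noteq> c" "b \<noteq> d" "a \<noteq> b" "b \<noteq> c" "c \<noteq> d" "d \<noteq> a"
    and C4: "adj a b" "adj b c" "adj c d" "adj d a"
  shows "adj a c \<or> adj b d"
proof (rule ccontr)
  note up = up_closedD[OF upset]
  assume non: "\<not> (adj a c \<or> adj b d)"
  obtain e where e: "e \<notin> {a, b, c, d}"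
  proof -
    have "card {a, b, c, d} < CARD(5)" using card_length[of "[a, b, c, d]"] by simp
    then have "{a, b, c, d} \<noteq> UNIV" by auto
    then show thesis using that by auto
  qed
  have all: "UNIV = {a, b, c, d, e}"
    by (rule sym, rule card_seteq) (use dist e in auto)
  have sym: "adj x y \<longleftrightarrow> adj y x" for x y by (simp add: adj insert_commute)
  have loop: "adj x x" if "adj x y" for x y using that up[of "- {x, y}" "- {x}"] by (auto simp: adj)
  \<comment> \<open>A large set outside $F$ misses two non-adjacent points; among $p$, $q$, $r$ only $p$ and $q$ can be such a pair.\<close>
  have co: "B = - {p, q}"
    if B: "B \<in> - F" "3 \<le> card B" and pq: "\<And>x. x \<notin> B \<Longrightarrow> x = p \<or> x = q \<or> x = r"
      and r: "adj r p" "adj r q" for B p q r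
  proof -
    have "B \<noteq> UNIV" using B(1) \<open>UNIV \<in> F\<close> by auto
    with B(2) obtain x y where xy: "x \<notin> B" "y \<notin> B" "B = - {x, y}"
      by (rule large_subset_5)
    have "\<not> adj x y" using xy B(1) adj by auto
    then have "{x, y} = {p, q}"
      using pq[OF xy(1)] pq[OF xy(2)] r sym[of r p] sym[of r q] loop[of r p] loop[of p r] loop[of q r]
      by auto
    then show ?thesis using xy by simp
  qed
  have "- {a, c} = - {b, d}"
  proof (rule partitionable_unique_tops[OF part, of "{b, e}" "{d, e}" "{a, e}" "{c, e}"])
    have *: "\<sigma> \<in> - F" if "\<sigma> \<subseteq> \<tau>" "\<tau> \<in> - F" for \<sigma> \<tau> using that up by blast
    have "- {a, c} \<in> - F" "- {b, d} \<in> - F" using non adj by auto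
    then show "{b, e} \<in> - F" "{d, e} \<in> - F" "{a, e} \<in> - F" "{c, e} \<in> - F"
      using dist e *[of "{b, e}" "- {a, c}"] *[of "{d, e}" "- {a, c}"]
        *[of "{a, e}" "- {b, d}"] *[of "{c, e}" "- {b, d}"] by simp_all
    show "B = - {a, c}" if B: "B \<in> - F" "3 \<le> card B" "{b, e} \<subseteq> B \<or> {d, e} \<subseteq> B" for B
    proof -
      have "x \<in> {a, b, c, d, e}" for x using all by blast
      then have "\<exists>r\<in>{b, d}. \<forall>x. x \<notin> B \<longrightarrow> x = a \<or> x = c \<or> x = r" using B(3) by blast
      then show ?thesis using co[OF B(1,2), of a c] C4 sym by blast
    qed
    show "B = - {b, d}" if B: "B \<in> - F" "3 \<le> card B" "{a, e} \<subseteq> B \<or> {c, e} \<subseteq> B" for B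
    proof -
      have "x \<in> {a, b, c, d, e}" for x using all by blast
      then have "\<exists>r\<in>{a, c}. \<forall>x. x \<notin> B \<longrightarrow> x = b \<or> x = d \<or> x = r" using B(3) by blast
      then show ?thesis using co[OF B(1,2), of b d] C4 sym by blast
    qed
    show "{b, e} \<inter> {d, e} = {a, e} \<inter> {c, e}" using dist e by auto
  qed
  then have "{a, c} = {b, d}" by simp
  then show False using dist by auto
qed

lemma alternating_sum_interval:
  fixes A B :: "'a::finite set"
  assumes "A \<subseteq> B"
  shows "(\<Sum>\<sigma>\<in>{A..B}. (- 1) ^ card \<sigma>) = (if A = B then (- 1) ^ card B else 0 :: int)"
proof (cases "A = B")
  case False
  then have "card {\<sigma>. \<sigma> \<subseteq> B \<and> A \<subseteq> \<sigma> \<and> even (card \<sigma>)} = card {\<sigma>. \<sigma> \<subseteq> B \<and> A \<subseteq> \<sigma> \<and> odd (card \<sigma>)}"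
    using assms by (intro card_subsupersets_even_odd) auto
  then have "(\<Sum>\<sigma>\<in>{A..B}. (- 1) ^ card \<sigma>) = (0 :: int)"
    by (intro sum_alternating_cancels) (simp_all add: conj_ac)
  then show ?thesis using False by simp
qed simp

text \<open>
  Only the one-element intervals contribute to the alternating sum; such an interval consists of a set that is
  its own top and so has odd size.
\<close>
lemma partitionable_alternating_sum:
  fixes G :: "'a::finite set set"
  assumes part: "partitionable k G"
    and odd: "\<And>\<sigma>. \<sigma> \<in> G \<Longrightarrow> k \<le> card \<sigma> \<Longrightarrow> odd (card \<sigma>)"
  shows "(\<Sum>\<sigma>\<in>G. (- 1) ^ card \<sigma>) \<le> (0 :: int)"
proof (rule partitionableE[OF part])
  fix P
  assume P: "\<And>A B. (A, B) \<in> P \<Longrightarrow> A \<subseteq> B \<and> k \<le> card B \<and> {A..B} \<subseteq> G"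
    and cover: "\<And>\<sigma>. \<sigma> \<in> G \<Longrightarrow> \<exists>A B. (A, B) \<in> P \<and> A \<subseteq> \<sigma> \<and> \<sigma> \<subseteq> B"
    and same: "\<And>A B A' B' \<sigma>. (A, B) \<in> P \<Longrightarrow> (A', B') \<in> P \<Longrightarrow> A \<subseteq> \<sigma> \<Longrightarrow> \<sigma> \<subseteq> B \<Longrightarrow>
           A' \<subseteq> \<sigma> \<Longrightarrow> \<sigma> \<subseteq> B' \<Longrightarrow> A = A' \<and> B = B'"
  have nonpos: "(\<Sum>\<sigma>\<in>{fst p..snd p}. (- 1) ^ card \<sigma>) \<le> (0 :: int)" if "p \<in> P" for p
  proof -
    have AB: "fst p \<subseteq> snd p" "k \<le> card (snd p)" "{fst p..snd p} \<subseteq> G" using P[of "fst p" "snd p"] that by auto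
    then have "snd p \<in> G" by (meson atLeastAtMost_iff order_refl subsetD)
    then show ?thesis using alternating_sum_interval[OF AB(1)] odd[OF _ AB(2)] by simp
  qed
  have "G = (\<Union>p\<in>P. {fst p..snd p})"
  proof (intro equalityI subsetI)
    show "\<sigma> \<in> (\<Union>p\<in>P. {fst p..snd p})" if "\<sigma> \<in> G" for \<sigma> using cover[OF that] by force
    show "\<sigma> \<in> G" if \<sigma>: "\<sigma> \<in> (\<Union>p\<in>P. {fst p..snd p})" for \<sigma>
    proof -
      obtain A B where "(A, B) \<in> P" "\<sigma> \<in> {A..B}" using \<sigma> by force
      then show ?thesis using P by blast
    qed
  qed
  then have "(\<Sum>\<sigma>\<in>G. (- 1) ^ card \<sigma>) = (\<Sum>p\<in>P. \<Sum>\<sigma>\<in>{fst p..snd p}. (- 1) ^ card \<sigma> :: int)"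
  proof (simp only:, intro sum.UNION_disjoint ballI impI)
    show "{fst p..snd p} \<inter> {fst q..snd q} = {}" if "p \<in> P" "q \<in> P" "p \<noteq> q" for p q
    proof (rule ccontr)
      assume "{fst p..snd p} \<inter> {fst q..snd q} \<noteq> {}"
      then obtain \<sigma> where "\<sigma> \<in> {fst p..snd p}" "\<sigma> \<in> {fst q..snd q}" by blast
      then show False using same[of "fst p" "snd p" "fst q" "snd q" \<sigma>] that by (auto simp: prod_eq_iff)
    qed
  qed auto
  also have "\<dots> \<le> 0" by (rule sum_nonpos) (rule nonpos)
  finally show ?thesis .
qed

lemma alternating_sum_small_5: "(\<Sum>\<sigma> | card (\<sigma> :: 5 set) \<le> 2. (- 1) ^ card \<sigma>) = (6 :: int)"
proof -
  have level: "(\<Sum>\<sigma> | card (\<sigma> :: 5 set) = j. (- 1) ^ card \<sigma>) = (int (5 choose j) * (- 1) ^ j)" for j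
    using n_subsets[of "UNIV :: 5 set" j] by simp
  have "k \<le> 2 \<longleftrightarrow> k = 0 \<or> k = 1 \<or> k = 2" for k :: nat by arith
  then have "{\<sigma> :: 5 set. card \<sigma> \<le> 2} = {\<sigma>. card \<sigma> = 0} \<union> ({\<sigma>. card \<sigma> = 1} \<union> {\<sigma>. card \<sigma> = 2})"
    by (simp only: Collect_disj_eq)
  then have "(\<Sum>\<sigma> | card (\<sigma> :: 5 set) \<le> 2. (- 1) ^ card \<sigma>) =
    (\<Sum>\<sigma> | card (\<sigma> :: 5 set) = 0. (- 1) ^ card \<sigma>) + ((\<Sum>\<sigma> | card (\<sigma> :: 5 set) = 1. (- 1) ^ card \<sigma>) +
    (\<Sum>\<sigma> | card (\<sigma> :: 5 set) = 2. (- 1) ^ card \<sigma> :: int))"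
    by (simp only:, subst sum.union_disjoint, simp, simp, force, subst sum.union_disjoint) auto
  then show ?thesis unfolding level by (simp add: choose_two)
qed

text \<open>
  Without a chord there are five non-edges, and no two points meet all of them.  So all sets with at most two
  elements lie outside $F$, larger sets outside $F$ are complements of non-edges, and the alternating sum over the
  complement of $F$ is at least $6 - 5 > 0$.
\<close>
lemma no_induced_5_cycle:
  fixes adj :: "5 \<Rightarrow> 5 \<Rightarrow> bool"
  assumes upset: "up_closed F"
    and "UNIV \<in> F" and part: "partitionable 3 (- F)"
    and adj: "\<And>x y. adj x y \<longleftrightarrow> - {x, y} \<in> F"
    and dist: "distinct [a, b, c, d, e]"
    and C5: "adj a b" "adj b c" "adj c d" "adj d e" "adj e a"
  shows "adj a c \<or> adj b d \<or> adj c e \<or> adj d a \<or> adj e b"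
proof (rule ccontr)
  note up = up_closedD[OF upset]
  assume "\<not> ?thesis"
  then have non: "\<not> adj a c" "\<not> adj b d" "\<not> adj c e" "\<not> adj d a" "\<not> adj e b" by auto
  have "card {a, b, c, d, e} = CARD(5)" using dist by simp
  then have all: "x \<in> {a, b, c, d, e}" for x using card_subset_eq[of "UNIV :: 5 set" "{a, b, c, d, e}"] by simp
  have sym: "adj x y \<longleftrightarrow> adj y x" for x y by (simp add: adj insert_commute)
  have loop: "adj x x" if "adj x y" for x y using that up[of "- {x, y}" "- {x}"] by (auto simp: adj)
  let ?N = "{- {a, c}, - {b, d}, - {c, e}, - {d, a}, - {e, b}}"
  have large: "B \<in> ?N" if B: "B \<in> - F" "3 \<le> card B" for B
  proof -
    have "B \<noteq> UNIV" using B(1) \<open>UNIV \<in> F\<close> by auto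
    with B(2) obtain x y where xy: "B = - {x, y}" by (rule large_subset_5)
    have "\<not> adj x y" using xy B(1) adj by auto
    then have "{x, y} \<in> {{a, c}, {b, d}, {c, e}, {d, a}, {e, b}}"
      using all[of x] all[of y] C5 sym loop by (elim insertE emptyE) (auto simp: insert_commute)
    then show ?thesis using xy by auto
  qed
  have small: "\<sigma> \<notin> F" if \<sigma>: "card \<sigma> \<le> 2" for \<sigma>
  proof
    assume "\<sigma> \<in> F"
    have "\<exists>x y. \<sigma> \<subseteq> {x, y}"
    proof (cases "\<sigma> = {}")
      case False
      have "3 \<le> card (- \<sigma>)" using \<sigma> by (simp add: Compl_eq_Diff_UNIV card_Diff_subset)
      moreover have "- \<sigma> \<noteq> UNIV" using False by auto
      ultimately obtain x y where "- \<sigma> = - {x, y}" by (rule large_subset_5)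
      then show ?thesis by auto
    qed auto
    then obtain x y where "\<sigma> \<subseteq> {x, y}" by blast
    then have "p \<in> {x, y} \<or> q \<in> {x, y}" if "\<not> adj p q" for p q
      using that up[OF \<open>\<sigma> \<in> F\<close>, of "- {p, q}"] by (auto simp: adj)
    from non[THEN this] show False using dist by auto
  qed
  have nonpos: "(\<Sum>\<sigma>\<in>- F. (- 1) ^ card \<sigma>) \<le> (0 :: int)"
  proof (rule partitionable_alternating_sum[OF part])
    fix \<sigma> assume "\<sigma> \<in> - F" "3 \<le> card \<sigma>"
    then have "\<sigma> \<in> ?N" by (rule large)
    then have "card \<sigma> = 3" using dist by (auto simp: Compl_eq_Diff_UNIV card_Diff_subset)
    then show "odd (card \<sigma>)" by simp
  qed
  have parts: "- F = {\<sigma>. card \<sigma> \<le> 2} \<union> {\<sigma> \<in> - F. 3 \<le> card \<sigma>}" using small by auto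
  have "(\<Sum>\<sigma>\<in>{\<sigma>. card \<sigma> \<le> 2} \<union> {\<sigma> \<in> - F. 3 \<le> card \<sigma>}. (- 1) ^ card \<sigma>) =
    (\<Sum>\<sigma> | card (\<sigma> :: 5 set) \<le> 2. (- 1) ^ card \<sigma>) +
    (\<Sum>\<sigma> | \<sigma> \<in> - F \<and> 3 \<le> card \<sigma>. (- 1) ^ card \<sigma> :: int)"
    by (rule sum.union_disjoint) auto
  note sums = this[folded parts]
  moreover have "(\<Sum>\<sigma> | \<sigma> \<in> - F \<and> 3 \<le> card \<sigma>. - 1 :: int) \<le> (\<Sum>\<sigma> | \<sigma> \<in> - F \<and> 3 \<le> card \<sigma>. (- 1) ^ card \<sigma>)"
  proof (rule sum_mono)
    show "- 1 \<le> (- 1 :: int) ^ card \<sigma>" for \<sigma> :: "5 set" by (cases "even (card \<sigma>)") auto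
  qed
  moreover have "card {\<sigma>. \<sigma> \<in> - F \<and> 3 \<le> card \<sigma>} \<le> 5"
  proof -
    have "card {\<sigma>. \<sigma> \<in> - F \<and> 3 \<le> card \<sigma>} \<le> card ?N" by (rule card_mono) (use large in auto)
    also have "\<dots> \<le> 5" using card_length[of "[- {a, c}, - {b, d}, - {c, e}, - {d, a}, - {e, b}]"] by simp
    finally show ?thesis .
  qed
  ultimately show False using sums nonpos alternating_sum_small_5 by simp
qed

text \<open>
  The graph joins $x$ and $y$ when $- \{x, y\} \in F$, with loops marking the points $x$ for which $- \{x\} \in F$.
  Since every set outside $F$ lies in a set $- \{x, y\} \notin F$, the complements of the members of $F$ are exactly the cliques.
\<close>
lemma complement_partitionable_3:
  fixes F :: "5 set set"
  assumes upset: "up_closed F"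
    and "UNIV \<in> F" and part: "partitionable 3 (- F)"
  shows "partitionable 4 F"
proof -
  note up = up_closedD[OF upset]
  define adj where "adj x y \<longleftrightarrow> - {x, y} \<in> F" for x y :: 5
  have sym: "adj x y \<longleftrightarrow> adj y x" for x y by (simp add: adj_def insert_commute)
  have loop: "adj x x" if "adj x y" for x y using that up[of "- {x, y}" "- {x}"] by (auto simp: adj_def)
  define Y where "Y = {v. adj v v}"
  have "partitionable (CARD(5) - 1) {\<sigma>. - \<sigma> \<subseteq> Y \<and> (\<forall>x\<in>- \<sigma>. \<forall>y\<in>- \<sigma>. adj x y)}"
  proof (rule partitionable_co_cliques)
    show "adj v v" if "v \<in> Y" for v using that by (simp add: Y_def)
    fix Z assume Z: "Z \<subseteq> Y" "Z \<noteq> {}"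
    \<comment> \<open>The simple graph induced on $Z$: isolated points and loops carry no edges, which makes points outside $Z$ harmless.\<close>
    define R where "R x y \<longleftrightarrow> x \<in> Z \<and> y \<in> Z \<and> x \<noteq> y \<and> adj x y" for x y
    show "\<exists>v\<in>Z. \<forall>x\<in>Z. \<forall>y\<in>Z. adj v x \<longrightarrow> adj v y \<longrightarrow> adj x y"
    proof (cases "\<exists>u w. R u w")
      case False
      obtain v where "v \<in> Z" using Z by blast
      moreover have "adj x y" if "x \<in> Z" "y \<in> Z" "adj v x" "adj v y" for x y
        using False that \<open>v \<in> Z\<close> Z unfolding R_def Y_def by blast
      ultimately show ?thesis by blast
    next
      case True
      then obtain u w where "R u w" by blast
      have "\<exists>v x. R v x \<and> (\<forall>y z. R v y \<longrightarrow> R v z \<longrightarrow> y \<noteq> z \<longrightarrow> R y z)"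
      proof (rule simplicial_vertex_5[of R u w])
        show "R u w" by fact
        show "R y x" if "R x y" for x y using that sym by (auto simp: R_def)
        show "\<not> R x x" for x by (simp add: R_def)
        show "R a c \<or> R b d" if "a \<noteq> c" "b \<noteq> d" "R a b" "R b c" "R c d" "R d a" for a b c d
          using that no_induced_4_cycle[OF upset \<open>UNIV \<in> F\<close> part adj_def, of a c b d] by (auto simp: R_def)
        show "R a c \<or> R b d \<or> R c e \<or> R d a \<or> R e b"
          if "distinct [a, b, c, d, e]" "R a b" "R b c" "R c d" "R d e" "R e a" for a b c d e
          using that no_induced_5_cycle[OF upset \<open>UNIV \<in> F\<close> part adj_def that(1)] by (auto simp: R_def)
      qed
      then obtain v x where v: "R v x" "\<And>y z. R v y \<Longrightarrow> R v z \<Longrightarrow> y \<noteq> z \<Longrightarrow> R y z" by blast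
      have "adj y z" if "y \<in> Z" "z \<in> Z" "adj v y" "adj v z" for y z
      proof (cases "y = z \<or> y = v \<or> z = v")
        case True
        then show ?thesis using that sym Z by (auto simp: Y_def)
      next
        case False
        then have "R v y" "R v z" using that v(1) by (auto simp: R_def)
        then show ?thesis using v(2) False by (auto simp: R_def)
      qed
      then show ?thesis using v(1) unfolding R_def by blast
    qed
  qed
  moreover have "{\<sigma>. - \<sigma> \<subseteq> Y \<and> (\<forall>x\<in>- \<sigma>. \<forall>y\<in>- \<sigma>. adj x y)} = F"
  proof (intro Set.set_eqI iffI)
    fix \<sigma> assume "\<sigma> \<in> F"
    then have "adj x y" if "x \<notin> \<sigma>" "y \<notin> \<sigma>" for x y
      using that up[of \<sigma> "- {x, y}"] by (auto simp: adj_def)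
    then show "\<sigma> \<in> {\<sigma>. - \<sigma> \<subseteq> Y \<and> (\<forall>x\<in>- \<sigma>. \<forall>y\<in>- \<sigma>. adj x y)}" by (auto simp: Y_def)
  next
    fix \<sigma> assume \<sigma>: "\<sigma> \<in> {\<sigma>. - \<sigma> \<subseteq> Y \<and> (\<forall>x\<in>- \<sigma>. \<forall>y\<in>- \<sigma>. adj x y)}"
    show "\<sigma> \<in> F"
    proof (rule ccontr)
      assume "\<sigma> \<notin> F"
      then have "\<sigma> \<in> - F" by simp
      with part obtain B where B: "B \<in> - F" "\<sigma> \<subseteq> B" "3 \<le> card B" by (rule partitionable_top)
      have "B \<noteq> UNIV" using B(1) \<open>UNIV \<in> F\<close> by auto
      with B(3) obtain x y where xy: "x \<notin> B" "y \<notin> B" "B = - {x, y}"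
        by (rule large_subset_5)
      then have "adj x y" using \<sigma> B(2) by blast
      then show False using xy B(1) by (simp add: adj_def)
    qed
  qed
  ultimately show ?thesis by simp
qed

section \<open>From a partition of a simplicial complex to one of its complement\<close>

theorem complement_partitionable:
  fixes F :: "5 set set"
  assumes upset: "up_closed F" and "F \<noteq> {}" "{} \<notin> F" and part: "partitionable d (- F)"
  shows "partitionable (Suc d) F"
proof -
  have "UNIV \<in> F" using assms(2) up_closedD[OF upset _ subset_UNIV] by blast
  have "d \<le> 4"
  proof -
    have "{} \<in> - F" using assms(3) by simp
    with part obtain B where B: "B \<in> - F" "{} \<subseteq> B" "d \<le> card B" by (rule partitionable_top)
    then have "B \<subset> UNIV" using \<open>UNIV \<in> F\<close> by blast
    then have "card B < CARD(5)" by (intro psubset_card_mono) auto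
    then show ?thesis using B(3) by simp
  qed
  then consider "d = 0" | "d = 1" | "d = 2" | "d = 3" | "d = 4" by linarith
  then show ?thesis
  proof cases
    case 1
    have "Suc 0 \<le> card \<sigma>" if "\<sigma> \<in> F" for \<sigma>
      using that assms(3) by (auto simp: Suc_le_eq card_gt_0_iff)
    then show ?thesis using partitionable_large 1 by blast
  next
    case 2
    then show ?thesis using complement_partitionable_1[OF upset assms(3)] part by (simp add: numeral_2_eq_2)
  next
    case 3
    then show ?thesis using complement_partitionable_2[OF upset assms(3)] part by simp
  next
    case 4
    then show ?thesis using complement_partitionable_3[OF upset \<open>UNIV \<in> F\<close>] part by simp
  next
    case 5
    then show ?thesis using complement_partitionable_corank_1[OF upset assms(2)] part by simp
  qed
qed

section \<open>Polynomials with prescribed support\<close>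

definition supported :: "'a set \<Rightarrow> ('a \<Rightarrow>\<^sub>0 'b::zero) set" where
  "supported E = {p. Poly_Mapping.keys p \<subseteq> E}"

definition restrict_to :: "'a set \<Rightarrow> ('a \<Rightarrow>\<^sub>0 'b::zero) \<Rightarrow> 'a \<Rightarrow>\<^sub>0 'b" where
  "restrict_to E p = Poly_Mapping.mapp (\<lambda>k v. if k \<in> E then v else 0) p"

lemma lookup_restrict_to:
  "Poly_Mapping.lookup (restrict_to E p) k = (if k \<in> E then Poly_Mapping.lookup p k else 0)"
  by (auto simp: restrict_to_def lookup_mapp when_def in_keys_iff)

lemma supportedD: "p \<in> supported E \<Longrightarrow> k \<notin> E \<Longrightarrow> Poly_Mapping.lookup p k = 0"
  by (auto simp: supported_def in_keys_iff)

lemma supportedI: "(\<And>k. k \<notin> E \<Longrightarrow> Poly_Mapping.lookup p k = 0) \<Longrightarrow> p \<in> supported E"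
  by (auto simp: supported_def in_keys_iff)

lemma restrict_to_supported: "restrict_to E p \<in> supported E"
  by (rule supportedI) (simp add: lookup_restrict_to)

lemma restrict_to_id: "p \<in> supported E \<Longrightarrow> restrict_to E p = p"
  by (rule poly_mapping_eqI) (auto simp: lookup_restrict_to supportedD)

lemma restrict_to_add: "restrict_to E (p + q) = restrict_to E p + restrict_to E (q :: _ \<Rightarrow>\<^sub>0 'b::monoid_add)"
  by (rule poly_mapping_eqI) (auto simp: lookup_restrict_to lookup_add)

lemma zero_supported: "0 \<in> supported E"
  by (rule supportedI) simp

lemma add_supported: "p \<in> supported E \<Longrightarrow> q \<in> supported E \<Longrightarrow> p + q \<in> supported (E :: 'a set)"
  for p q :: "'a \<Rightarrow>\<^sub>0 'b::monoid_add"
  by (rule supportedI) (simp add: lookup_add supportedD)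

lemma sum_supported: "(\<And>i. i \<in> A \<Longrightarrow> p i \<in> supported E) \<Longrightarrow> sum p A \<in> supported E"
  for p :: "'i \<Rightarrow> 'a \<Rightarrow>\<^sub>0 'b::comm_monoid_add"
  by (rule supportedI) (auto simp: lookup_sum intro!: sum.neutral supportedD)

lemma single_supported: "k \<in> E \<Longrightarrow> Poly_Mapping.single k c \<in> supported E"
  by (rule supportedI) (auto simp: lookup_single when_def)

lemma restrict_to_sum_disjoint:
  fixes p :: "'i \<Rightarrow> 'a \<Rightarrow>\<^sub>0 'b::comm_monoid_add"
  assumes "finite J" "disjoint_family_on B J" "\<And>i. i \<in> J \<Longrightarrow> p i \<in> supported (B i)" "j \<in> J"
  shows "restrict_to (B j) (sum p J) = p j"
proof (rule poly_mapping_eqI)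
  fix k
  show "Poly_Mapping.lookup (restrict_to (B j) (sum p J)) k = Poly_Mapping.lookup (p j) k"
  proof (cases "k \<in> B j")
    case True
    then have "k \<notin> B i" if "i \<in> J" "i \<noteq> j" for i
      using assms(2,4) that unfolding disjoint_family_on_def by blast
    then have "(\<Sum>i\<in>J. Poly_Mapping.lookup (p i) k) = (\<Sum>i\<in>J. if i = j then Poly_Mapping.lookup (p j) k else 0)"
      by (intro sum.cong) (auto intro: supportedD[OF assms(3)])
    then show ?thesis using True assms(1,4) by (simp add: lookup_restrict_to lookup_sum)
  next
    case False
    then show ?thesis using supportedD[OF assms(3)[OF assms(4)]] by (simp add: lookup_restrict_to)
  qed
qed

lemma sum_restrict_to_disjoint:
  fixes p :: "'a \<Rightarrow>\<^sub>0 'b::comm_monoid_add"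
  assumes "finite J" "disjoint_family_on B J" "p \<in> supported (\<Union>j\<in>J. B j)"
  shows "(\<Sum>j\<in>J. restrict_to (B j) p) = p"
proof (rule poly_mapping_eqI)
  fix k
  show "Poly_Mapping.lookup (\<Sum>j\<in>J. restrict_to (B j) p) k = Poly_Mapping.lookup p k"
  proof (cases "\<exists>j\<in>J. k \<in> B j")
    case True
    then obtain j where j: "j \<in> J" "k \<in> B j" by blast
    then have "k \<in> B i \<longleftrightarrow> i = j" if "i \<in> J" for i
      using assms(2) that unfolding disjoint_family_on_def by blast
    then have "(\<Sum>i\<in>J. Poly_Mapping.lookup (restrict_to (B i) p) k) = (\<Sum>i\<in>J. if i = j then Poly_Mapping.lookup p k else 0)"
      by (intro sum.cong) (auto simp: lookup_restrict_to)
    then show ?thesis using j assms(1) by (simp add: lookup_sum)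
  next
    case False
    then show ?thesis using supportedD[OF assms(3), of k] by (simp add: lookup_sum lookup_restrict_to)
  qed
qed

lemma lookup_times_single:
  fixes f :: "('n \<Rightarrow>\<^sub>0 nat) \<Rightarrow>\<^sub>0 'k::field"
  shows "Poly_Mapping.lookup (f * Poly_Mapping.single a c) (k + a) = Poly_Mapping.lookup f k * c"
proof -
  have "(\<lambda>q. Poly_Mapping.lookup (Poly_Mapping.single a c) q when k + a = l + q) = (\<lambda>q. (c when k = l) when q = a)" for l
    by (auto simp: fun_eq_iff lookup_single when_def)
  then have "Poly_Mapping.lookup (f * Poly_Mapping.single a c) (k + a)
      = Sum_any (\<lambda>l. Poly_Mapping.lookup f l * Sum_any (\<lambda>q. (c when k = l) when q = a))"
    unfolding lookup_mult by presburger
  also have "\<dots> = Sum_any (\<lambda>l. Poly_Mapping.lookup f l * c when l = k)"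
    by (simp add: mult_when eq_commute[of k])
  also have "\<dots> = Poly_Mapping.lookup f k * c" by simp
  finally show ?thesis .
qed

lemma keys_times_single:
  fixes f :: "('n \<Rightarrow>\<^sub>0 nat) \<Rightarrow>\<^sub>0 'k::field"
  shows "Poly_Mapping.keys (f * Poly_Mapping.single a c) \<subseteq> (\<lambda>k. k + a) ` Poly_Mapping.keys f"
  using keys_mult[of f "Poly_Mapping.single a c"] by (auto split: if_splits)

lemma times_single_cancel:
  fixes f g :: "('n \<Rightarrow>\<^sub>0 nat) \<Rightarrow>\<^sub>0 'k::field"
  assumes "c \<noteq> 0" "f * Poly_Mapping.single a c = g * Poly_Mapping.single a c"
  shows "f = g"
proof (rule poly_mapping_eqI)
  fix k
  show "Poly_Mapping.lookup f k = Poly_Mapping.lookup g k"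
    using assms lookup_times_single[of f a c k] lookup_times_single[of g a c k] by simp
qed

text \<open>
  The exponents of the monomials in $x^a K[Z]$.
\<close>
definition box :: "('n \<Rightarrow>\<^sub>0 nat) \<Rightarrow> 'n set \<Rightarrow> ('n \<Rightarrow>\<^sub>0 nat) set" where
  "box a Z = (\<lambda>k. k + a) ` {k. Poly_Mapping.keys k \<subseteq> Z}"

lemma base_in_box: "a \<in> box a Z"
  unfolding box_def by (rule image_eqI[of _ _ 0]) auto

lemma supported_box:
  fixes c :: "'k::field"
  assumes "c \<noteq> 0"
  shows "supported (box a Z) = (\<lambda>f. f * Poly_Mapping.single a c) ` subring_in Z"
proof (intro equalityI subsetI)
  fix p :: "('a, 'k) mpoly" assume p: "p \<in> supported (box a Z)"
  have inj: "inj (\<lambda>k. k + a)" by (simp add: inj_def)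
  \<comment> \<open>The quotient of $p$ by the term $c x^a$.\<close>
  define f where "f = Poly_Mapping.map_key (\<lambda>k. k + a) p * Poly_Mapping.single 0 (inverse c)"
  have f: "Poly_Mapping.lookup f k = Poly_Mapping.lookup p (k + a) * inverse c" for k
    using lookup_times_single[of "Poly_Mapping.map_key (\<lambda>k. k + a) p" 0 "inverse c" k]
    by (simp add: f_def map_key.rep_eq[OF inj])
  have "f * Poly_Mapping.single a c = p"
  proof (rule poly_mapping_eqI)
    fix k
    show "Poly_Mapping.lookup (f * Poly_Mapping.single a c) k = Poly_Mapping.lookup p k"
    proof (cases "\<exists>l. k = l + a")
      case True
      then obtain l where "k = l + a" by blast
      then show ?thesis using lookup_times_single[of f a c l] f[of l] assms by simp
    next
      case False
      then have "k \<notin> Poly_Mapping.keys (f * Poly_Mapping.single a c)" "k \<notin> box a Z"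
        using keys_times_single[of f a c] by (auto simp: box_def)
      then show ?thesis using supportedD[OF p] by (simp add: in_keys_iff)
    qed
  qed
  moreover have "f \<in> subring_in Z"
    unfolding subring_in_def
  proof (intro CollectI ballI)
    fix k assume "k \<in> Poly_Mapping.keys f"
    then have "k + a \<in> box a Z" using p f[of k] by (auto simp: supported_def in_keys_iff)
    then show "Poly_Mapping.keys k \<subseteq> Z" by (auto simp: box_def)
  qed
  ultimately show "p \<in> (\<lambda>f. f * Poly_Mapping.single a c) ` subring_in Z" by blast
next
  fix p assume "p \<in> (\<lambda>f. f * Poly_Mapping.single a c) ` subring_in Z"
  then show "p \<in> supported (box a Z)"
    using keys_times_single by (fastforce simp: supported_def box_def subring_in_def)
qed

lemma mpoly_part_single:
  assumes "p \<in> mpoly_part d" "p \<noteq> 0"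
  obtains a c where "p = Poly_Mapping.single a c" "c \<noteq> 0"
proof -
  obtain a where a: "a \<in> Poly_Mapping.keys p" using assms(2) by (metis all_not_in_conv keys_eq_empty)
  have "k = a" if "k \<in> Poly_Mapping.keys p" for k
    using assms(1) a that by (intro poly_mapping_eqI) (simp add: mpoly_part_def; metis of_nat_eq_iff)
  then have "p = Poly_Mapping.single a (Poly_Mapping.lookup p a)"
    by (intro poly_mapping_eqI) (auto simp: lookup_single when_def in_keys_iff)
  then show thesis using that a by (metis in_keys_iff)
qed

lemma single_mpoly_part: "Poly_Mapping.single a c \<in> mpoly_part (\<lambda>i. int (Poly_Mapping.lookup a i))"
  by (auto simp: mpoly_part_def)

section \<open>Graded modules with a basis of monomials\<close>

text \<open>
  A common description of $I$ and $S/I$ by the exponent set $E$ of the monomials that form a basis: the module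
  is identified through $\theta$ with the polynomials supported on $E$, and a product with a polynomial is
  computed by dropping the terms outside $E$.  Associativity of the action is a condition on $E$, since dropped
  terms must not return under further multiplication.
\<close>
locale monomial_module =
  fixes M :: "('n, 'k::field, 'm) graded_module" and E :: "('n \<Rightarrow>\<^sub>0 nat) set"
    and \<theta> :: "('n, 'k) mpoly \<Rightarrow> 'm"
  assumes inj: "inj_on \<theta> (supported E)"
    and carrier: "carrier M = \<theta> ` supported E"
    and zero: "\<zero>\<^bsub>M\<^esub> = \<theta> 0"
    and add: "\<And>p q. p \<in> supported E \<Longrightarrow> q \<in> supported E \<Longrightarrow> \<theta> p \<oplus>\<^bsub>M\<^esub> \<theta> q = \<theta> (p + q)"
    and smult: "\<And>f p. p \<in> supported E \<Longrightarrow> f \<odot>\<^bsub>M\<^esub> \<theta> p = \<theta> (restrict_to E (f * p))"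
    and smult_assoc: "\<And>f g x. x \<in> carrier M \<Longrightarrow> (f * g) \<odot>\<^bsub>M\<^esub> x = f \<odot>\<^bsub>M\<^esub> (g \<odot>\<^bsub>M\<^esub> x)"
    and homogeneous: "\<And>m. homogeneous M m \<longleftrightarrow> (\<exists>p\<in>supported E. (\<exists>d. p \<in> mpoly_part d) \<and> m = \<theta> p)"
begin

sublocale abelian_monoid M
proof (rule abelian_monoidI)
  show "\<zero>\<^bsub>M\<^esub> \<in> carrier M" by (simp add: zero carrier zero_supported)
qed (auto simp: carrier add zero add_supported zero_supported ac_simps)

lemma eq_iff: "p \<in> supported E \<Longrightarrow> q \<in> supported E \<Longrightarrow> \<theta> p = \<theta> q \<longleftrightarrow> p = q"
  using inj by (auto simp: inj_on_def)

lemma in_carrier: "p \<in> supported E \<Longrightarrow> \<theta> p \<in> carrier M"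
  by (simp add: carrier)

lemma finsum_eq:
  assumes "finite A" "\<And>i. i \<in> A \<Longrightarrow> p i \<in> supported E" "\<And>i. i \<in> A \<Longrightarrow> g i = \<theta> (p i)"
  shows "(\<Oplus>\<^bsub>M\<^esub>i\<in>A. g i) = \<theta> (sum p A)"
  using assms
proof (induction A rule: finite_induct)
  case (insert i A)
  then show ?case by (simp add: Pi_def in_carrier add sum_supported)
qed (simp add: zero)

lemma smult_closed: "x \<in> carrier M \<Longrightarrow> f \<odot>\<^bsub>M\<^esub> x \<in> carrier M"
  by (auto simp: carrier smult restrict_to_supported)

lemma smult_add:
  "x \<in> carrier M \<Longrightarrow> y \<in> carrier M \<Longrightarrow> f \<odot>\<^bsub>M\<^esub> (x \<oplus>\<^bsub>M\<^esub> y) = f \<odot>\<^bsub>M\<^esub> x \<oplus>\<^bsub>M\<^esub> f \<odot>\<^bsub>M\<^esub> y"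
  by (auto simp: carrier add smult restrict_to_supported add_supported restrict_to_add distrib_left)

lemma smult_zero: "f \<odot>\<^bsub>M\<^esub> \<zero>\<^bsub>M\<^esub> = \<zero>\<^bsub>M\<^esub>"
  by (simp add: zero smult zero_supported restrict_to_id)

lemma zero_smult: "x \<in> carrier M \<Longrightarrow> 0 \<odot>\<^bsub>M\<^esub> x = \<zero>\<^bsub>M\<^esub>"
  by (auto simp: carrier zero smult zero_supported restrict_to_id)

lemma one_smult: "x \<in> carrier M \<Longrightarrow> 1 \<odot>\<^bsub>M\<^esub> x = x"
  by (auto simp: carrier smult restrict_to_id)

lemma smult_finsum:
  assumes "finite A" "\<And>i. i \<in> A \<Longrightarrow> g i \<in> carrier M"
  shows "f \<odot>\<^bsub>M\<^esub> (\<Oplus>\<^bsub>M\<^esub>i\<in>A. g i) = (\<Oplus>\<^bsub>M\<^esub>i\<in>A. f \<odot>\<^bsub>M\<^esub> g i)"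
  using assms
proof (induction A rule: finite_induct)
  case (insert i A)
  then show ?case by (simp add: Pi_def smult_closed smult_add)
qed (simp add: smult_zero)

lemma zero_in_cyclic_space: "m \<in> carrier M \<Longrightarrow> \<zero>\<^bsub>M\<^esub> \<in> cyclic_space M m Z"
  unfolding cyclic_space_def
  by (rule image_eqI[of _ _ 0]) (auto simp: zero_smult subring_in_def)

lemma cyclic_space_zero: "cyclic_space M \<zero>\<^bsub>M\<^esub> Z = {\<zero>\<^bsub>M\<^esub>}"
  using zero_in_cyclic_space[of "\<zero>\<^bsub>M\<^esub>" Z] by (auto simp: cyclic_space_def smult_zero)

lemma generator_in_cyclic_space: "m \<in> carrier M \<Longrightarrow> m \<in> cyclic_space M m Z"
  unfolding cyclic_space_def
  by (rule image_eqI[of _ _ 1]) (auto simp: one_smult subring_in_def)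

lemma smult_single:
  assumes "c \<noteq> 0" "box a Z \<subseteq> E" "f \<in> subring_in Z"
  shows "f * Poly_Mapping.single a c \<in> supported E"
    and "f \<odot>\<^bsub>M\<^esub> \<theta> (Poly_Mapping.single a c) = \<theta> (f * Poly_Mapping.single a c)"
proof -
  have "f * Poly_Mapping.single a c \<in> supported (box a Z)"
    using supported_box[OF assms(1), of a Z] assms(3) by auto
  then show *: "f * Poly_Mapping.single a c \<in> supported E"
    using assms(2) by (auto simp: supported_def)
  have "a \<in> E" using base_in_box[of a Z] assms(2) by auto
  then show "f \<odot>\<^bsub>M\<^esub> \<theta> (Poly_Mapping.single a c) = \<theta> (f * Poly_Mapping.single a c)"
    by (simp add: smult single_supported restrict_to_id[OF *])
qed

lemma cyclic_space_single:
  assumes "c \<noteq> 0" "box a Z \<subseteq> E"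
  shows "cyclic_space M (\<theta> (Poly_Mapping.single a c)) Z = \<theta> ` supported (box a Z)"
  unfolding cyclic_space_def supported_box[OF assms(1)] image_image
  using smult_single(2)[OF assms] by (intro image_cong) auto

text \<open>
  As long as the box stays inside $E$ no term of a product is dropped, so the generator alone is a basis.
\<close>
lemma stanley_space_single:
  assumes "c \<noteq> 0" "box a Z \<subseteq> E"
  shows "stanley_space M (\<theta> (Poly_Mapping.single a c)) Z"
proof -
  let ?m = "\<theta> (Poly_Mapping.single a c)"
  have a: "Poly_Mapping.single a c \<in> supported E"
    using base_in_box[of a Z] assms(2) by (auto intro: single_supported)
  have m: "?m \<in> carrier M" using a by (rule in_carrier)
  have sum: "(\<Oplus>\<^bsub>M\<^esub>b\<in>{b. h b \<noteq> 0}. h b \<odot>\<^bsub>M\<^esub> b) = h ?m \<odot>\<^bsub>M\<^esub> ?m" if "{b. h b \<noteq> 0} \<subseteq> {?m}" for h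
  proof (cases "h ?m = 0")
    case True
    then have "{b. h b \<noteq> 0} = {}" using that by blast
    then show ?thesis using True m by (simp add: zero_smult)
  next
    case False
    then have "{b. h b \<noteq> 0} = {?m}" using that by blast
    then show ?thesis using m by (simp add: smult_closed)
  qed
  have "is_basis M Z (cyclic_space M ?m Z) {?m}"
    unfolding is_basis_def
  proof (intro conjI ballI)
    show "{?m} \<subseteq> cyclic_space M ?m Z" using generator_in_cyclic_space[OF m] by blast
    fix x assume "x \<in> cyclic_space M ?m Z"
    then obtain f where f: "f \<in> subring_in Z" "x = f \<odot>\<^bsub>M\<^esub> ?m" by (auto simp: cyclic_space_def)
    show "\<exists>!h. range h \<subseteq> subring_in Z \<and> finite {b. h b \<noteq> 0} \<and> {b. h b \<noteq> 0} \<subseteq> {?m} \<and>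
        x = (\<Oplus>\<^bsub>M\<^esub>b\<in>{b. h b \<noteq> 0}. h b \<odot>\<^bsub>M\<^esub> b)"
    proof (rule ex1I[of _ "(\<lambda>_. 0)(?m := f)"])
      have sub: "{b. ((\<lambda>_. 0)(?m := f)) b \<noteq> 0} \<subseteq> {?m}" by auto
      show "range ((\<lambda>_. 0)(?m := f)) \<subseteq> subring_in Z \<and> finite {b. ((\<lambda>_. 0)(?m := f)) b \<noteq> 0} \<and>
        {b. ((\<lambda>_. 0)(?m := f)) b \<noteq> 0} \<subseteq> {?m} \<and>
        x = (\<Oplus>\<^bsub>M\<^esub>b\<in>{b. ((\<lambda>_. 0)(?m := f)) b \<noteq> 0}. ((\<lambda>_. 0)(?m := f)) b \<odot>\<^bsub>M\<^esub> b)"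
      proof (intro conjI)
        show "range ((\<lambda>_. 0)(?m := f)) \<subseteq> subring_in Z"
          using f(1) by (auto simp: subring_in_def)
        show "finite {b. ((\<lambda>_. 0)(?m := f)) b \<noteq> 0}" using sub by (rule finite_subset) simp
        show "x = (\<Oplus>\<^bsub>M\<^esub>b\<in>{b. ((\<lambda>_. 0)(?m := f)) b \<noteq> 0}. ((\<lambda>_. 0)(?m := f)) b \<odot>\<^bsub>M\<^esub> b)"
          unfolding sum[OF sub] using f(2) by simp
      qed (fact sub)
      fix h
      assume h: "range h \<subseteq> subring_in Z \<and> finite {b. h b \<noteq> 0} \<and> {b. h b \<noteq> 0} \<subseteq> {?m} \<and>
        x = (\<Oplus>\<^bsub>M\<^esub>b\<in>{b. h b \<noteq> 0}. h b \<odot>\<^bsub>M\<^esub> b)"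
      then have hm: "h ?m \<in> subring_in Z" by blast
      have "x = h ?m \<odot>\<^bsub>M\<^esub> ?m" using h sum[of h] by simp
      then have "\<theta> (h ?m * Poly_Mapping.single a c) = \<theta> (f * Poly_Mapping.single a c)"
        using smult_single(2)[OF assms hm] smult_single(2)[OF assms f(1)] f(2) by simp
      then have "h ?m * Poly_Mapping.single a c = f * Poly_Mapping.single a c"
        using eq_iff smult_single(1)[OF assms hm] smult_single(1)[OF assms f(1)] by blast
      then have "h ?m = f" using times_single_cancel[OF assms(1)] by blast
      then show "h = (\<lambda>_. 0)(?m := f)" using h by (auto simp: fun_eq_iff)
    qed
  qed
  moreover have "homogeneous M ?m"
    unfolding homogeneous using a single_mpoly_part[of a c] by blast
  ultimately show ?thesis unfolding stanley_space_def by blast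
qed

text \<open>
  If $x^k$ with $k \in \mathbb{N}^Z$ killed the generator $m \neq 0$, multiplying the coefficients of $m$ in a
  basis by $x^k$ would give a second representation of zero.
\<close>
lemma stanley_space_box:
  assumes space: "stanley_space M (\<theta> (Poly_Mapping.single a c)) Z" and "c \<noteq> 0" "a \<in> E"
  shows "box a Z \<subseteq> E"
proof (rule ccontr)
  let ?m = "\<theta> (Poly_Mapping.single a c)"
  assume "\<not> box a Z \<subseteq> E"
  then obtain k where k: "Poly_Mapping.keys k \<subseteq> Z" "k + a \<notin> E" by (auto simp: box_def)
  let ?t = "Poly_Mapping.single k (1 :: 'k)"
  have a: "Poly_Mapping.single a c \<in> supported E" using \<open>a \<in> E\<close> by (rule single_supported)
  have m: "?m \<in> carrier M" using a by (rule in_carrier)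
  have "restrict_to E (?t * Poly_Mapping.single a c) = 0"
    by (rule poly_mapping_eqI) (use k(2) in \<open>auto simp: lookup_restrict_to mult_single lookup_single when_def\<close>)
  then have kill: "?t \<odot>\<^bsub>M\<^esub> ?m = \<zero>\<^bsub>M\<^esub>" by (simp add: smult[OF a] zero)
  obtain B where "is_basis M Z (cyclic_space M ?m Z) B" using space by (auto simp: stanley_space_def)
  then have BN: "B \<subseteq> cyclic_space M ?m Z"
    and basis: "\<And>x. x \<in> cyclic_space M ?m Z \<Longrightarrow> \<exists>!h. range h \<subseteq> subring_in Z \<and> finite {b. h b \<noteq> 0} \<and>
      {b. h b \<noteq> 0} \<subseteq> B \<and> x = (\<Oplus>\<^bsub>M\<^esub>b\<in>{b. h b \<noteq> 0}. h b \<odot>\<^bsub>M\<^esub> b)"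
    unfolding is_basis_def by blast+
  have BM: "b \<in> carrier M" if "b \<in> B" for b
    using BN that m by (auto simp: cyclic_space_def intro!: smult_closed)
  obtain h where h: "range h \<subseteq> subring_in Z" "finite {b. h b \<noteq> 0}" "{b. h b \<noteq> 0} \<subseteq> B"
      "?m = (\<Oplus>\<^bsub>M\<^esub>b\<in>{b. h b \<noteq> 0}. h b \<odot>\<^bsub>M\<^esub> b)"
    using ex1_implies_ex[OF basis[OF generator_in_cyclic_space[OF m]]] by blast
  \<comment> \<open>The coefficients of $x^k m = 0$.\<close>
  define h' where "h' b = h b * ?t" for b
  have supp: "{b. h' b \<noteq> 0} = {b. h b \<noteq> 0}"
    using times_single_cancel[of 1 _ k 0] by (auto simp: h'_def)
  have "(\<Oplus>\<^bsub>M\<^esub>b\<in>{b. h' b \<noteq> 0}. h' b \<odot>\<^bsub>M\<^esub> b) = (\<Oplus>\<^bsub>M\<^esub>b\<in>{b. h b \<noteq> 0}. ?t \<odot>\<^bsub>M\<^esub> (h b \<odot>\<^bsub>M\<^esub> b))"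
    unfolding supp
  proof (rule finsum_cong')
    show "h' b \<odot>\<^bsub>M\<^esub> b = ?t \<odot>\<^bsub>M\<^esub> (h b \<odot>\<^bsub>M\<^esub> b)" if "b \<in> {b. h b \<noteq> 0}" for b
      using smult_assoc[of b ?t "h b"] BM h(3) that by (auto simp: h'_def mult.commute)
  qed (use BM h(3) in \<open>auto intro!: smult_closed\<close>)
  also have "\<dots> = ?t \<odot>\<^bsub>M\<^esub> ?m"
    by (subst h(4), subst smult_finsum) (use BM h(2,3) in \<open>auto intro!: smult_closed\<close>)
  finally have h'sum: "\<zero>\<^bsub>M\<^esub> = (\<Oplus>\<^bsub>M\<^esub>b\<in>{b. h' b \<noteq> 0}. h' b \<odot>\<^bsub>M\<^esub> b)" using kill by simp
  have "h' b \<in> subring_in Z" for b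
  proof -
    have hb: "h b \<in> subring_in Z" using h(1) by blast
    show ?thesis
      unfolding subring_in_def
    proof (intro CollectI ballI)
      fix e assume "e \<in> Poly_Mapping.keys (h' b)"
      then obtain l where "l \<in> Poly_Mapping.keys (h b)" "e = l + k"
        using keys_times_single[of "h b" k 1] by (auto simp: h'_def)
      then show "Poly_Mapping.keys e \<subseteq> Z"
        using keys_add[of l k] k(1) hb by (auto simp: subring_in_def)
    qed
  qed
  moreover define Q where "Q h \<longleftrightarrow> range h \<subseteq> subring_in Z \<and> finite {b. h b \<noteq> 0} \<and> {b. h b \<noteq> 0} \<subseteq> B \<and>
      \<zero>\<^bsub>M\<^esub> = (\<Oplus>\<^bsub>M\<^esub>b\<in>{b. h b \<noteq> 0}. h b \<odot>\<^bsub>M\<^esub> b)" for h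
  ultimately have "Q h'"
    using h'sum h(2,3) supp by auto
  moreover have "Q (\<lambda>_. 0)" by (auto simp: Q_def subring_in_def)
  moreover have "\<exists>!h. Q h" using basis[OF zero_in_cyclic_space[OF m]] by (simp add: Q_def)
  ultimately have "h' = (\<lambda>_. 0)" by blast
  then have "{b. h b \<noteq> 0} = {}" using supp by auto
  then have "?m = \<theta> 0" using h(4) zero by simp
  then have "Poly_Mapping.single a c = 0" using eq_iff[OF a zero_supported] by simp
  then show False using \<open>c \<noteq> 0\<close> by (metis lookup_single_eq lookup_zero)
qed

text \<open>
  The component of an element in a box is obtained by keeping its terms there.
\<close>
lemma stanley_decomposition_boxes:
  fixes L :: "(('n \<Rightarrow>\<^sub>0 nat) \<times> 'n set) list"
  defines "B \<equiv> \<lambda>j. box (fst (L ! j)) (snd (L ! j))"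
  assumes disj: "disjoint_family_on B {..<length L}" and cover: "(\<Union>j<length L. B j) = E"
  shows "stanley_decomposition M (map (\<lambda>(a, Z). (\<theta> (Poly_Mapping.single a 1), Z)) L)"
proof -
  let ?D = "map (\<lambda>(a, Z). (\<theta> (Poly_Mapping.single a 1), Z)) L"
  have BE: "B j \<subseteq> E" if "j < length L" for j using cover that by blast
  have BE': "supported (B j) \<subseteq> (supported E :: ('n, 'k) mpoly set)" if "j < length L" for j
    using BE[OF that] by (auto simp: supported_def)
  have cyclic: "cyclic_space M (fst (?D ! j)) (snd (?D ! j)) = \<theta> ` supported (B j)" if "j < length L" for j
    using cyclic_space_single[of 1 "fst (L ! j)" "snd (L ! j)"] BE[OF that] that
    by (simp add: B_def case_prod_beta)
  have space: "stanley_space M m Z" if mZ: "(m, Z) \<in> set ?D" for m Z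
  proof -
    obtain a where a: "(a, Z) \<in> set L" "m = \<theta> (Poly_Mapping.single a 1)"
      using mZ by auto
    then obtain j where "j < length L" "L ! j = (a, Z)" by (auto simp: in_set_conv_nth)
    then have "box a Z \<subseteq> E" using BE[of j] by (simp add: B_def)
    then show ?thesis unfolding a(2) by (intro stanley_space_single) simp_all
  qed
  have unique: "\<exists>!y. y \<in> (\<Pi>\<^sub>E j\<in>{..<length ?D}. cyclic_space M (fst (?D ! j)) (snd (?D ! j))) \<and>
      x = (\<Oplus>\<^bsub>M\<^esub>j\<in>{..<length ?D}. y j)" if x: "x \<in> carrier M" for x
  proof -
    obtain p where p: "p \<in> supported E" "x = \<theta> p" using x by (auto simp: carrier)
    have PiE_eq: "(\<Pi>\<^sub>E j\<in>{..<length ?D}. cyclic_space M (fst (?D ! j)) (snd (?D ! j))) =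
        (\<Pi>\<^sub>E j\<in>{..<length L}. \<theta> ` supported (B j))"
      unfolding length_map by (rule PiE_cong) (rule cyclic, simp)
    let ?y = "\<lambda>j\<in>{..<length L}. \<theta> (restrict_to (B j) p)"
    have yin: "?y \<in> (\<Pi>\<^sub>E j\<in>{..<length L}. \<theta> ` supported (B j))"
      using restrict_to_supported by auto
    have "\<exists>!y. y \<in> (\<Pi>\<^sub>E j\<in>{..<length L}. \<theta> ` supported (B j)) \<and> x = (\<Oplus>\<^bsub>M\<^esub>j\<in>{..<length L}. y j)"
    proof (rule ex1I[of _ ?y], intro conjI)
      show "?y \<in> (\<Pi>\<^sub>E j\<in>{..<length L}. \<theta> ` supported (B j))" by (fact yin)
      have "(\<Oplus>\<^bsub>M\<^esub>j\<in>{..<length L}. ?y j) = \<theta> (\<Sum>j<length L. restrict_to (B j) p)"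
        using BE' restrict_to_supported by (intro finsum_eq) auto
      then show "x = (\<Oplus>\<^bsub>M\<^esub>j\<in>{..<length L}. ?y j)"
        using sum_restrict_to_disjoint[of "{..<length L}" B p] disj p cover by simp
      fix y
      assume y: "y \<in> (\<Pi>\<^sub>E j\<in>{..<length L}. \<theta> ` supported (B j)) \<and> x = (\<Oplus>\<^bsub>M\<^esub>j\<in>{..<length L}. y j)"
      then have "\<forall>j\<in>{..<length L}. \<exists>q\<in>supported (B j). y j = \<theta> q" by (auto simp: PiE_iff)
      then obtain q where q: "\<And>j. j < length L \<Longrightarrow> q j \<in> supported (B j) \<and> y j = \<theta> (q j)"
        by (metis lessThan_iff)
      have "x = \<theta> (\<Sum>j<length L. q j)"
        using y q BE' by (subst finsum_eq[symmetric, of _ q y]) auto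
      moreover have "(\<Sum>j<length L. q j) \<in> supported E"
        using q BE' by (intro sum_supported) auto
      ultimately have "p = (\<Sum>j<length L. q j)" using p eq_iff by auto
      then have "restrict_to (B j) p = q j" if "j < length L" for j
        using restrict_to_sum_disjoint[of "{..<length L}" B q j] disj q that by auto
      then show "y = ?y"
        using PiE_ext[OF conjunct1[OF y] yin] q by simp
    qed
    then show ?thesis unfolding PiE_eq by simp
  qed
  show ?thesis
    unfolding stanley_decomposition_def
  proof (intro conjI ballI)
    show "case mZ of (m, Z) \<Rightarrow> stanley_space M m Z" if "mZ \<in> set ?D" for mZ
      using space[of "fst mZ" "snd mZ"] that by (cases mZ) simp
  qed (rule unique)
qed

text \<open>
  A homogeneous element is zero or a scalar multiple of a monomial.  Zero generators contribute nothing and are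
  left out of $J$.  The monomials of the remaining summands cover $E$ because a monomial must occur in one of
  the components of its decomposition, and a monomial shared by two summands would have two decompositions.
\<close>
lemma boxes_of_stanley_decomposition:
  assumes dec: "stanley_decomposition M D"
  obtains J a where "J \<subseteq> {..<length D}"
    and "disjoint_family_on (\<lambda>j. box (a j) (snd (D ! j))) J"
    and "(\<Union>j\<in>J. box (a j) (snd (D ! j))) = E"
proof -
  let ?C = "\<lambda>j. cyclic_space M (fst (D ! j)) (snd (D ! j))"
  have space: "stanley_space M (fst (D ! j)) (snd (D ! j))" if "j < length D" for j
    using dec that unfolding stanley_decomposition_def by (metis case_prod_beta nth_mem)
  have unique: "\<exists>!y. y \<in> (\<Pi>\<^sub>E j\<in>{..<length D}. ?C j) \<and> x = (\<Oplus>\<^bsub>M\<^esub>j\<in>{..<length D}. y j)"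
    if "x \<in> carrier M" for x
    using dec that unfolding stanley_decomposition_def by blast
  define J where "J = {j. j < length D \<and> fst (D ! j) \<noteq> \<zero>\<^bsub>M\<^esub>}"
  have "\<forall>j\<in>J. \<exists>ac. fst (D ! j) = \<theta> (Poly_Mapping.single (fst ac) (snd ac)) \<and> snd ac \<noteq> 0 \<and> fst ac \<in> E"
  proof
    fix j assume "j \<in> J"
    then have j: "j < length D" "fst (D ! j) \<noteq> \<theta> 0" by (auto simp: J_def zero)
    obtain p d where p: "p \<in> supported E" "p \<in> mpoly_part d" "fst (D ! j) = \<theta> p"
      using space[OF j(1)] unfolding stanley_space_def homogeneous by blast
    then have "p \<noteq> 0" using j(2) by auto
    with p(2) obtain a c where "p = Poly_Mapping.single a c" "c \<noteq> 0" by (rule mpoly_part_single)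
    then show "\<exists>ac. fst (D ! j) = \<theta> (Poly_Mapping.single (fst ac) (snd ac)) \<and> snd ac \<noteq> 0 \<and> fst ac \<in> E"
      using p by (intro exI[of _ "(a, c)"]) (auto simp: supported_def)
  qed
  then obtain ac where ac: "\<forall>j\<in>J. fst (D ! j) = \<theta> (Poly_Mapping.single (fst (ac j)) (snd (ac j))) \<and>
      snd (ac j) \<noteq> 0 \<and> fst (ac j) \<in> E"
    by (rule bchoice[THEN exE])
  define B where "B j = box (fst (ac j)) (snd (D ! j))" for j
  have BE: "B j \<subseteq> E" if j: "j \<in> J" for j
    unfolding B_def
  proof (rule stanley_space_box)
    show "stanley_space M (\<theta> (Poly_Mapping.single (fst (ac j)) (snd (ac j)))) (snd (D ! j))"
      using space[of j] bspec[OF ac j] j by (simp add: J_def)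
  qed (use bspec[OF ac j] in simp_all)
  have C: "?C j = \<theta> ` supported (B j)" if j: "j \<in> J" for j
    using cyclic_space_single[of "snd (ac j)" "fst (ac j)" "snd (D ! j)"] BE[OF j] bspec[OF ac j]
    by (simp add: B_def)
  have C0: "?C j = {\<theta> 0}" if "j < length D" "j \<notin> J" for j
    using that cyclic_space_zero by (simp add: J_def zero)
  have zero_C: "\<theta> 0 \<in> ?C j" if "j < length D" for j
    using C[of j] C0[of j] that zero_supported by (cases "j \<in> J") auto
  have BE': "p \<in> supported E" if "j \<in> J" "p \<in> supported (B j)" for j p
    using BE that by (auto simp: supported_def)
  have cover: "e \<in> (\<Union>j\<in>J. B j)" if e: "e \<in> E" for e
  proof -
    let ?e = "Poly_Mapping.single e (1 :: 'k)"
    have e': "?e \<in> supported E" using e by (rule single_supported)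
    obtain y where y: "y \<in> (\<Pi>\<^sub>E j\<in>{..<length D}. ?C j)" "\<theta> ?e = (\<Oplus>\<^bsub>M\<^esub>j\<in>{..<length D}. y j)"
      using unique[OF in_carrier[OF e']] by blast
    have "\<forall>j\<in>{..<length D}. \<exists>q. y j = \<theta> q \<and> q \<in> supported (if j \<in> J then B j else {})"
    proof
      fix j assume j: "j \<in> {..<length D}"
      then have "y j \<in> ?C j" using y(1) by (auto simp: PiE_iff)
      then show "\<exists>q. y j = \<theta> q \<and> q \<in> supported (if j \<in> J then B j else {})"
        using C[of j] C0[of j] j by (cases "j \<in> J") (auto simp: zero_supported)
    qed
    then obtain q where q: "\<forall>j\<in>{..<length D}. y j = \<theta> (q j) \<and> q j \<in> supported (if j \<in> J then B j else {})"
      by (rule bchoice[THEN exE])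
    have qE: "q j \<in> supported E" if "j \<in> {..<length D}" for j
      using bspec[OF q that] BE'[of j "q j"] by (cases "j \<in> J") (auto simp: supported_def)
    have "\<theta> ?e = \<theta> (\<Sum>j<length D. q j)"
      unfolding y(2) by (rule finsum_eq) (use q qE in auto)
    moreover have "(\<Sum>j<length D. q j) \<in> supported E" by (rule sum_supported) (rule qE)
    ultimately have "?e = (\<Sum>j<length D. q j)" using eq_iff[OF e'] by blast
    then have "Poly_Mapping.lookup (\<Sum>j<length D. q j) e \<noteq> 0" by (metis lookup_single_eq zero_neq_one)
    then obtain j where "j < length D" "Poly_Mapping.lookup (q j) e \<noteq> 0"
      unfolding lookup_sum by (metis lessThan_iff sum.neutral)
    then show ?thesis
      using bspec[OF q, of j] supportedD[of "q j" "if j \<in> J then B j else {}" e] by (auto split: if_splits)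
  qed
  have disj: "B i \<inter> B j = {}" if ij: "i \<in> J" "j \<in> J" "i \<noteq> j" for i j
  proof (rule ccontr)
    assume "B i \<inter> B j \<noteq> {}"
    then obtain e where e: "e \<in> B i" "e \<in> B j" by blast
    let ?e = "Poly_Mapping.single e (1 :: 'k)"
    have e': "?e \<in> supported E" using e BE ij by (intro single_supported) auto
    \<comment> \<open>The monomial $x^e$ written with the summand $i$ alone.\<close>
    define y where "y i = (\<lambda>l\<in>{..<length D}. \<theta> (if l = i then ?e else 0))" for i
    have y: "y i \<in> (\<Pi>\<^sub>E j\<in>{..<length D}. ?C j) \<and> \<theta> ?e = (\<Oplus>\<^bsub>M\<^esub>j\<in>{..<length D}. y i j)"
      if i: "i \<in> J" "e \<in> B i" for i
    proof
      show "y i \<in> (\<Pi>\<^sub>E j\<in>{..<length D}. ?C j)"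
        unfolding y_def
      proof (rule restrict_PiE_iff[THEN iffD2], rule ballI)
        fix l assume "l \<in> {..<length D}"
        then show "\<theta> (if l = i then ?e else 0) \<in> ?C l"
          using C[OF i(1)] zero_C[of l] single_supported[OF i(2)] by auto
      qed
      have "i < length D" using i by (simp add: J_def)
      have "(\<Oplus>\<^bsub>M\<^esub>j\<in>{..<length D}. y i j) = \<theta> (\<Sum>l<length D. if l = i then ?e else 0)"
        by (rule finsum_eq) (auto simp: y_def e' zero_supported)
      then show "\<theta> ?e = (\<Oplus>\<^bsub>M\<^esub>j\<in>{..<length D}. y i j)" using \<open>i < length D\<close> by simp
    qed
    have "y i = y j"
    proof (rule ex1E[OF unique[OF in_carrier[OF e']]])
      fix z
      assume "\<forall>w. w \<in> (\<Pi>\<^sub>E j\<in>{..<length D}. ?C j) \<and> \<theta> ?e = (\<Oplus>\<^bsub>M\<^esub>j\<in>{..<length D}. w j) \<longrightarrow> w = z"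
      then have z: "w = z" if "w \<in> (\<Pi>\<^sub>E j\<in>{..<length D}. ?C j) \<and> \<theta> ?e = (\<Oplus>\<^bsub>M\<^esub>j\<in>{..<length D}. w j)" for w
        using that by blast
      show ?thesis using z[OF y[OF ij(1) e(1)]] z[OF y[OF ij(2) e(2)]] by simp
    qed
    then have "y i i = y j i" by simp
    then have "\<theta> ?e = \<theta> 0" using ij by (auto simp: y_def J_def)
    then show False using eq_iff[OF e' zero_supported] by (metis lookup_single_eq lookup_zero zero_neq_one)
  qed
  show thesis
  proof (rule that[of J "\<lambda>j. fst (ac j)"])
    show "J \<subseteq> {..<length D}" by (auto simp: J_def)
    show "disjoint_family_on (\<lambda>j. box (fst (ac j)) (snd (D ! j))) J"
      using disj unfolding disjoint_family_on_def B_def by blast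
    show "(\<Union>j\<in>J. box (fst (ac j)) (snd (D ! j))) = E"
      using cover BE unfolding B_def by blast
  qed
qed

end

section \<open>Stanley depth as a partition problem in the Boolean lattice\<close>

definition indicator_exponent :: "'n::finite set \<Rightarrow> 'n \<Rightarrow>\<^sub>0 nat" where
  "indicator_exponent \<sigma> = Abs_poly_mapping (\<lambda>i. if i \<in> \<sigma> then 1 else 0)"

lemma lookup_indicator_exponent [simp]:
  "Poly_Mapping.lookup (indicator_exponent \<sigma>) i = (if i \<in> \<sigma> then 1 else 0)"
  by (simp add: indicator_exponent_def)

lemma keys_indicator_exponent [simp]: "Poly_Mapping.keys (indicator_exponent \<sigma>) = \<sigma>"
  by (auto simp: in_keys_iff split: if_splits)

lemma box_iff:
  "e \<in> box a Z \<longleftrightarrow> (\<forall>i. Poly_Mapping.lookup a i \<le> Poly_Mapping.lookup e i \<and>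
     (Poly_Mapping.lookup a i = Poly_Mapping.lookup e i \<or> i \<in> Z))"
proof
  assume "e \<in> box a Z"
  then show "\<forall>i. Poly_Mapping.lookup a i \<le> Poly_Mapping.lookup e i \<and>
     (Poly_Mapping.lookup a i = Poly_Mapping.lookup e i \<or> i \<in> Z)"
    by (auto simp: box_def lookup_add in_keys_iff)
next
  assume *: "\<forall>i. Poly_Mapping.lookup a i \<le> Poly_Mapping.lookup e i \<and>
     (Poly_Mapping.lookup a i = Poly_Mapping.lookup e i \<or> i \<in> Z)"
  have "e = (e - a) + a"
    by (rule poly_mapping_eqI) (use * in \<open>simp add: lookup_add lookup_minus\<close>)
  moreover have "Poly_Mapping.keys (e - a) \<subseteq> Z"
    using * by (force simp: in_keys_iff lookup_minus)
  ultimately show "e \<in> box a Z" unfolding box_def by blast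
qed

lemma box_indicator_exponent:
  assumes "A \<subseteq> B"
  shows "box (indicator_exponent A) B = {e. Poly_Mapping.keys e \<in> {A..B}}"
proof (rule Set.set_eqI)
  fix e :: "'a \<Rightarrow>\<^sub>0 nat"
  have "(if i \<in> A then 1 else 0) \<le> Poly_Mapping.lookup e i \<and> ((if i \<in> A then 1 else 0) = Poly_Mapping.lookup e i \<or> i \<in> B) \<longleftrightarrow>
    (i \<in> A \<longrightarrow> i \<in> Poly_Mapping.keys e) \<and> (i \<in> Poly_Mapping.keys e \<longrightarrow> i \<in> B)" for i
    using assms by (auto simp: in_keys_iff)
  then show "e \<in> box (indicator_exponent A) B \<longleftrightarrow> e \<in> {e. Poly_Mapping.keys e \<in> {A..B}}"
    by (simp add: box_iff subset_eq) blast
qed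

text \<open>
  A box contains squarefree exponents only if its own base point is squarefree; this is what cuts a
  box down to an interval of supports.
\<close>
lemma indicator_exponent_in_box:
  "indicator_exponent \<sigma> \<in> box a Z \<longleftrightarrow>
     (\<forall>i. Poly_Mapping.lookup a i \<le> 1) \<and> \<sigma> \<in> {Poly_Mapping.keys a..Poly_Mapping.keys a \<union> Z}"
proof -
  have "Poly_Mapping.lookup a i \<le> (if i \<in> \<sigma> then 1 else 0) \<and> (Poly_Mapping.lookup a i = (if i \<in> \<sigma> then 1 else 0) \<or> i \<in> Z) \<longleftrightarrow>
    Poly_Mapping.lookup a i \<le> 1 \<and> (i \<in> Poly_Mapping.keys a \<longrightarrow> i \<in> \<sigma>) \<and> (i \<in> \<sigma> \<longrightarrow> i \<in> Poly_Mapping.keys a \<union> Z)" for i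
    by (auto simp: in_keys_iff)
  then show ?thesis by (simp add: box_iff subset_eq) blast
qed

lemma sdepth_decomposition_le:
  "(m, Z) \<in> set D \<Longrightarrow> sdepth_decomposition D \<le> card Z"
  unfolding sdepth_decomposition_def by (rule Min_le) force+

locale squarefree_module = monomial_module M "{e. Poly_Mapping.keys e \<in> G}" \<theta>
  for M :: "('n::finite, 'k::field, 'm) graded_module" and G :: "'n set set"
    and \<theta> :: "('n, 'k) mpoly \<Rightarrow> 'm" +
  assumes nonempty: "G \<noteq> {}"
begin

lemma decomposition_of_partition:
  assumes "partitionable k G"
  obtains D where "stanley_decomposition M D" "k \<le> sdepth_decomposition D"
proof -
  obtain P where P: "\<forall>(A, B)\<in>P. A \<subseteq> B \<and> k \<le> card B" "G = (\<Union>(A, B)\<in>P. {A..B})"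
      "disjoint_family_on (\<lambda>(A, B). {A..B}) P"
    using assms[unfolded partitionable_def] by (elim exE conjE) (rule that)
  obtain ps where ps: "set ps = P" "distinct ps" using finite_distinct_list[of P] by auto
  define L where "L = map (\<lambda>(A, B). (indicator_exponent A, B)) ps"
  let ?B = "\<lambda>j. box (fst (L ! j)) (snd (L ! j))"
  have box: "?B j = {e. Poly_Mapping.keys e \<in> {fst (ps ! j)..snd (ps ! j)}}" if "j < length ps" for j
  proof -
    have "ps ! j \<in> P" using nth_mem[OF that] ps(1) by simp
    then have "fst (ps ! j) \<subseteq> snd (ps ! j)" using P(1) by (auto simp: case_prod_beta)
    then show ?thesis using that by (simp add: L_def case_prod_beta box_indicator_exponent)
  qed
  have "stanley_decomposition M (map (\<lambda>(a, Z). (\<theta> (Poly_Mapping.single a 1), Z)) L)"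
  proof (rule stanley_decomposition_boxes)
    show "disjoint_family_on ?B {..<length L}"
      unfolding disjoint_family_on_def
    proof (intro ballI impI)
      fix i j assume ij: "i \<in> {..<length L}" "j \<in> {..<length L}" "i \<noteq> j"
      then have "ps ! i \<in> P" "ps ! j \<in> P" "ps ! i \<noteq> ps ! j"
        using nth_mem ps by (auto simp: L_def nth_eq_iff_index_eq)
      then have "{fst (ps ! i)..snd (ps ! i)} \<inter> {fst (ps ! j)..snd (ps ! j)} = {}"
        using disjoint_family_onD[OF P(3)] by (simp add: case_prod_beta)
      then show "?B i \<inter> ?B j = {}" using box ij unfolding L_def by auto
    qed
    have "(\<Union>j<length L. ?B j) = (\<Union>p\<in>set ps. {e. Poly_Mapping.keys e \<in> {fst p..snd p}})"
      using box by (simp add: L_def set_conv_nth) blast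
    also have "\<dots> = {e. Poly_Mapping.keys e \<in> G}"
      unfolding P(2) ps(1) case_prod_beta by blast
    finally show "(\<Union>j<length L. ?B j) = {e. Poly_Mapping.keys e \<in> G}" .
  qed
  moreover have "k \<le> sdepth_decomposition (map (\<lambda>(a, Z). (\<theta> (Poly_Mapping.single a 1), Z)) L)"
    unfolding sdepth_decomposition_def
  proof (rule Min.boundedI)
    have "P \<noteq> {}" using nonempty P(2) by auto
    then show "(\<lambda>(m, Z). card Z) ` set (map (\<lambda>(a, Z). (\<theta> (Poly_Mapping.single a 1), Z)) L) \<noteq> {}"
      using ps(1) by (auto simp: L_def)
  qed (use P(1) in \<open>auto simp: L_def ps(1)\<close>)
  ultimately show thesis by (rule that)
qed

lemma partition_of_decomposition:
  assumes "stanley_decomposition M D"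
  shows "D \<noteq> []" "partitionable (sdepth_decomposition D) G"
proof -
  obtain J a where J: "J \<subseteq> {..<length D}"
    and disj: "disjoint_family_on (\<lambda>j. box (a j) (snd (D ! j))) J"
    and cover: "(\<Union>j\<in>J. box (a j) (snd (D ! j))) = {e. Poly_Mapping.keys e \<in> G}"
    using boxes_of_stanley_decomposition[OF assms] by blast
  define J' where "J' = {j \<in> J. \<forall>i. Poly_Mapping.lookup (a j) i \<le> 1}"
  define S where "S j = {Poly_Mapping.keys (a j)..Poly_Mapping.keys (a j) \<union> snd (D ! j)}" for j
  have S: "\<sigma> \<in> S j \<longleftrightarrow> indicator_exponent \<sigma> \<in> box (a j) (snd (D ! j))" if "j \<in> J'" for \<sigma> j
    using that unfolding S_def J'_def indicator_exponent_in_box by simp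
  have G: "G = (\<Union>j\<in>J'. S j)"
  proof (rule Set.set_eqI)
    fix \<sigma>
    have "\<sigma> \<in> G \<longleftrightarrow> indicator_exponent \<sigma> \<in> (\<Union>j\<in>J. box (a j) (snd (D ! j)))"
      unfolding cover by simp
    also have "\<dots> \<longleftrightarrow> \<sigma> \<in> (\<Union>j\<in>J'. S j)"
      unfolding UN_iff indicator_exponent_in_box J'_def S_def by blast
    finally show "\<sigma> \<in> G \<longleftrightarrow> \<sigma> \<in> (\<Union>j\<in>J'. S j)" .
  qed
  then show "D \<noteq> []" using nonempty J by (auto simp: J'_def)
  have "partitionable (sdepth_decomposition D) (\<Union>j\<in>J'. S j)"
  proof (rule partitionable_UN)
    fix j assume "j \<in> J'"
    then have "(fst (D ! j), snd (D ! j)) \<in> set D" using J by (auto simp: J'_def)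
    then have "sdepth_decomposition D \<le> card (snd (D ! j))" by (rule sdepth_decomposition_le)
    also have "\<dots> \<le> card (Poly_Mapping.keys (a j) \<union> snd (D ! j))" by (rule card_mono) auto
    finally show "partitionable (sdepth_decomposition D) (S j)"
      unfolding S_def by (intro partitionable_interval) auto
  next
    show "disjoint_family_on S J'"
      unfolding disjoint_family_on_def
    proof (intro ballI impI)
      fix i j assume ij: "i \<in> J'" "j \<in> J'" "i \<noteq> j"
      then have "box (a i) (snd (D ! i)) \<inter> box (a j) (snd (D ! j)) = {}"
        using disjoint_family_onD[OF disj] by (auto simp: J'_def)
      then show "S i \<inter> S j = {}" using S ij by blast
    qed
  qed
  then show "partitionable (sdepth_decomposition D) G" unfolding G .
qed

lemma sdepth_decomposition_bounded:
  assumes "stanley_decomposition M D"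
  shows "sdepth_decomposition D \<le> CARD('n)"
proof -
  obtain mZ where "mZ \<in> set D" using partition_of_decomposition(1)[OF assms] by (meson list.set_sel(1))
  then have "sdepth_decomposition D \<le> card (snd mZ)"
    by (intro sdepth_decomposition_le[of "fst mZ"]) simp
  also have "\<dots> \<le> CARD('n)" by (rule card_mono) auto
  finally show ?thesis .
qed

theorem le_sdepth_iff: "k \<le> sdepth M \<longleftrightarrow> partitionable k G"
proof -
  let ?V = "sdepth_decomposition ` {D. stanley_decomposition M D}"
  have "?V \<subseteq> {..CARD('n)}" using sdepth_decomposition_bounded by auto
  then have fin: "finite ?V" by (rule finite_subset) simp
  obtain D\<^sub>0 where D0: "stanley_decomposition M D\<^sub>0"
    using decomposition_of_partition[OF partitionable_large[of G 0]] by auto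
  then have ne: "?V \<noteq> {}" by blast
  show ?thesis
  proof
    assume k: "k \<le> sdepth M"
    obtain D where D: "stanley_decomposition M D" "sdepth M = sdepth_decomposition D"
      using Max_in[OF fin ne] unfolding sdepth_def by auto
    have "partitionable (sdepth_decomposition D) G" by (rule partition_of_decomposition(2)) (rule D)
    then show "partitionable k G" using k D(2) by (auto intro: partitionable_mono)
  next
    assume "partitionable k G"
    then obtain D where D: "stanley_decomposition M D" "k \<le> sdepth_decomposition D"
      by (rule decomposition_of_partition)
    then have "sdepth_decomposition D \<le> sdepth M"
      unfolding sdepth_def using fin by (intro Max_ge) auto
    then show "k \<le> sdepth M" using D(2) by simp
  qed
qed

end

section \<open>Squarefree monomial ideals and their quotients\<close>

lemma mpoly_ring_sel:
  "carrier ring_of_type_algebra = UNIV" "x \<oplus>\<^bsub>ring_of_type_algebra\<^esub> y = x + y"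
  "x \<otimes>\<^bsub>ring_of_type_algebra\<^esub> y = x * y" "\<zero>\<^bsub>ring_of_type_algebra\<^esub> = 0"
  by (simp_all add: ring_of_type_algebra_def)

lemma ideal_supported:
  fixes F :: "'n set set"
  assumes upset: "up_closed F"
  shows "ideal (supported {e. Poly_Mapping.keys e \<in> F}) (mpoly_ring :: ('n, 'k::field) mpoly ring)"
proof (rule idealI)
  let ?I = "supported {e. Poly_Mapping.keys e \<in> F} :: ('n, 'k) mpoly set"
  show ring: "ring (mpoly_ring :: ('n, 'k) mpoly ring)" by (rule ring_from_type_algebra)
  interpret ring "mpoly_ring :: ('n, 'k) mpoly ring" by (rule ring)
  have mult: "f * p \<in> ?I" if "p \<in> ?I" for f p
    unfolding supported_def
  proof (intro CollectI subsetI)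
    fix e assume "e \<in> Poly_Mapping.keys (f * p)"
    then obtain a b where ab: "e = a + b" "b \<in> Poly_Mapping.keys p" using keys_mult[of f p] by blast
    then have "Poly_Mapping.keys b \<in> F" using that by (auto simp: supported_def)
    moreover have "Poly_Mapping.keys b \<subseteq> Poly_Mapping.keys e"
      unfolding ab(1) by (auto simp: in_keys_iff lookup_add)
    ultimately show "Poly_Mapping.keys e \<in> F" using up_closedD[OF upset] by blast
  qed
  show "x \<otimes>\<^bsub>mpoly_ring\<^esub> a \<in> ?I" "a \<otimes>\<^bsub>mpoly_ring\<^esub> x \<in> ?I" if "a \<in> ?I" for a x
    using mult[OF that, of x] by (simp_all add: mpoly_ring_sel mult.commute)
  show "subgroup ?I (add_monoid mpoly_ring)"
  proof (rule subgroup.intro)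
    show "inv\<^bsub>add_monoid mpoly_ring\<^esub> p \<in> ?I" if "p \<in> ?I" for p
    proof -
      have "\<ominus>\<^bsub>mpoly_ring\<^esub> p = - p" by (rule minus_equality) (simp_all add: mpoly_ring_sel)
      moreover have "- p \<in> ?I" using that by (auto simp: supported_def in_keys_iff)
      ultimately show ?thesis by (simp add: a_inv_def)
    qed
  qed (auto simp: mpoly_ring_sel add_supported zero_supported)
qed

text \<open>
  A monomial lies in $I$ if and only if its support contains the support of a generator, as the generators are squarefree.
\<close>
lemma squarefree_monomial_ideal_supported:
  fixes I :: "('n, 'k::field) mpoly set"
  assumes "squarefree_monomial_ideal I"
  obtains F where "up_closed F" "I = supported {e. Poly_Mapping.keys e \<in> F}"
proof -
  obtain G where G: "\<forall>g\<in>G. squarefree_monomial g" "I = Idl\<^bsub>mpoly_ring\<^esub> G"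
    using assms by (auto simp: squarefree_monomial_ideal_def)
  interpret ring "mpoly_ring :: ('n, 'k) mpoly ring" by (rule ring_from_type_algebra)
  interpret I: ideal I "mpoly_ring :: ('n, 'k) mpoly ring"
    unfolding G(2) by (rule genideal_ideal) (simp add: mpoly_ring_sel)
  define F where "F = {\<sigma>. \<exists>a. monomial a \<in> G \<and> Poly_Mapping.keys a \<subseteq> \<sigma>}"
  have up: "up_closed F" by (auto simp: up_closed_def F_def)
  have "I \<subseteq> supported {e. Poly_Mapping.keys e \<in> F}"
    unfolding G(2)
  proof (rule genideal_minimal[OF ideal_supported[OF up]], rule subsetI)
    fix g assume g: "g \<in> G"
    then obtain a where "g = monomial a" using G(1) by (auto simp: squarefree_monomial_def)
    then show "g \<in> supported {e. Poly_Mapping.keys e \<in> F}"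
      using g by (auto simp: monomial_def F_def intro!: single_supported)
  qed
  moreover have "p \<in> I" if p: "p \<in> supported {e. Poly_Mapping.keys e \<in> F}" for p
  proof -
    have single: "Poly_Mapping.single e c \<in> I" if e: "Poly_Mapping.keys e \<in> F" for e c
    proof -
      obtain a where a: "monomial a \<in> G" "Poly_Mapping.keys a \<subseteq> Poly_Mapping.keys e" using e by (auto simp: F_def)
      then obtain b where b: "monomial a = (monomial b :: ('n, 'k) mpoly)" "\<forall>i. Poly_Mapping.lookup b i \<le> 1"
        using G(1) by (fastforce simp: squarefree_monomial_def)
      have "a = b" using b(1) by (metis monomial_def keys_single singleton_inject zero_neq_one)
      have le: "Poly_Mapping.lookup a i \<le> Poly_Mapping.lookup e i" for i
      proof (cases "i \<in> Poly_Mapping.keys a")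
        case True
        then have "i \<in> Poly_Mapping.keys e" using a(2) by blast
        then have "1 \<le> Poly_Mapping.lookup e i" by (simp add: in_keys_iff Suc_le_eq)
        moreover have "Poly_Mapping.lookup a i \<le> 1" using b(2) \<open>a = b\<close> by blast
        ultimately show ?thesis by linarith
      qed (simp add: in_keys_iff)
      have "(e - a) + a = e" by (rule poly_mapping_eqI) (simp add: lookup_add lookup_minus le)
      then have "Poly_Mapping.single e c = Poly_Mapping.single (e - a) c * monomial a"
        by (simp add: monomial_def mult_single)
      moreover have "monomial a \<in> I" unfolding G(2) using a(1) genideal_self[of G] by (auto simp: mpoly_ring_sel)
      ultimately show ?thesis using I.I_l_closed[of "monomial a" "Poly_Mapping.single (e - a) c"] by (simp add: mpoly_ring_sel)
    qed
    have "(\<Sum>e\<in>A. Poly_Mapping.single e (Poly_Mapping.lookup p e)) \<in> I"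
      if "finite A" "A \<subseteq> Poly_Mapping.keys p" for A
      using that
    proof (induction A rule: finite_induct)
      case empty
      then show ?case using I.zero_closed by (simp add: mpoly_ring_sel)
    next
      case (insert e A)
      then have "Poly_Mapping.keys e \<in> F" using p by (auto simp: supported_def)
      then show ?case using insert single I.a_closed by (simp add: mpoly_ring_sel)
    qed
    moreover have "(\<Sum>e\<in>Poly_Mapping.keys p. Poly_Mapping.single e (Poly_Mapping.lookup p e)) = p"
      by (rule poly_mapping_eqI) (simp add: lookup_sum lookup_single when_def in_keys_iff)
    ultimately show ?thesis by (metis finite_keys order_refl)
  qed
  ultimately show thesis using that[OF up] by blast
qed

lemma squarefree_module_ideal:
  fixes F :: "'n::finite set set"
  assumes upset: "up_closed F" and "F \<noteq> {}"
  shows "squarefree_module (ideal_module (supported {e. Poly_Mapping.keys e \<in> F}) :: ('n, 'k::field, _) graded_module) F (\<lambda>p. p)"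
proof -
  let ?I = "supported {e. Poly_Mapping.keys e \<in> F} :: ('n, 'k) mpoly set"
  have mult: "f * p \<in> ?I" if "p \<in> ?I" for f p
    using ideal.I_l_closed[OF ideal_supported[OF upset] that, of f] by (simp add: mpoly_ring_sel)
  show ?thesis
    by unfold_locales
      (auto simp: ideal_module_def homogeneous_def restrict_to_id mult assms(2) mult.assoc)
qed

text \<open>
  Every coset has exactly one representative without terms in $I$.
\<close>
lemma squarefree_module_quotient:
  fixes F :: "'n::finite set set"
  assumes upset: "up_closed F" and "- F \<noteq> {}"
  defines "I \<equiv> supported {e. Poly_Mapping.keys e \<in> F} :: ('n, 'k::field) mpoly set"
  shows "squarefree_module (quotient_module I) (- F) (\<lambda>p. I +>\<^bsub>mpoly_ring\<^esub> p)"
proof -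
  interpret I: ideal I "mpoly_ring :: ('n, 'k) mpoly ring"
    unfolding I_def by (rule ideal_supported[OF upset])
  let ?E = "{e. Poly_Mapping.keys e \<in> - F}"
  have coset_eq: "I +>\<^bsub>mpoly_ring\<^esub> p = I +>\<^bsub>mpoly_ring\<^esub> q \<longleftrightarrow> p - q \<in> I" for p q
  proof -
    have "p \<in> I +>\<^bsub>mpoly_ring\<^esub> q \<longleftrightarrow> p - q \<in> I"
      by (auto simp: a_r_coset_def' mpoly_ring_sel intro: bexI[of _ "p - q"])
    then show ?thesis
      using I.a_repr_independence'[of p q] I.a_rcos_self[of p] by (auto simp: mpoly_ring_sel)
  qed
  have restrict: "I +>\<^bsub>mpoly_ring\<^esub> restrict_to ?E p = I +>\<^bsub>mpoly_ring\<^esub> p" for p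
    unfolding coset_eq by (subst I_def, rule supportedI) (auto simp: lookup_minus lookup_restrict_to)
  have mult: "(I +>\<^bsub>mpoly_ring\<^esub> p) \<otimes>\<^bsub>mpoly_ring Quot I\<^esub> (I +>\<^bsub>mpoly_ring\<^esub> q) = I +>\<^bsub>mpoly_ring\<^esub> (p * q)" for p q
    using I.rcoset_mult_add[of p q] by (simp add: FactRing_def mpoly_ring_sel)
  have carrier: "carrier (mpoly_ring Quot I) = range (\<lambda>p. I +>\<^bsub>mpoly_ring\<^esub> p)"
    by (auto simp: FactRing_def A_RCOSETS_def' mpoly_ring_sel)
  have inj: "inj_on (\<lambda>p. I +>\<^bsub>mpoly_ring\<^esub> p) (supported ?E)"
  proof (rule inj_onI, rule poly_mapping_eqI)
    fix p q :: "('n, 'k) mpoly" and e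
    assume pq: "p \<in> supported ?E" "q \<in> supported ?E" and "I +>\<^bsub>mpoly_ring\<^esub> p = I +>\<^bsub>mpoly_ring\<^esub> q"
    then have "p - q \<in> supported {e. Poly_Mapping.keys e \<in> F}" using coset_eq by (simp add: I_def)
    with pq show "Poly_Mapping.lookup p e = Poly_Mapping.lookup q e"
      using supportedD[of "p - q" "{e. Poly_Mapping.keys e \<in> F}" e] supportedD[of p ?E e] supportedD[of q ?E e]
      by (cases "Poly_Mapping.keys e \<in> F") (auto simp: lookup_minus)
  qed
  have onto: "range (\<lambda>p. I +>\<^bsub>mpoly_ring\<^esub> p) = (\<lambda>p. I +>\<^bsub>mpoly_ring\<^esub> p) ` supported ?E"
  proof (intro equalityI subsetI)
    fix x assume "x \<in> range (\<lambda>p. I +>\<^bsub>mpoly_ring\<^esub> p)"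
    then show "x \<in> (\<lambda>p. I +>\<^bsub>mpoly_ring\<^esub> p) ` supported ?E"
      using restrict restrict_to_supported by (metis (no_types, lifting) imageE image_eqI)
  qed auto
  show ?thesis
  proof unfold_locales
    show "inj_on (\<lambda>p. I +>\<^bsub>mpoly_ring\<^esub> p) (supported ?E)" by (rule inj)
    show "carrier (quotient_module I) = (\<lambda>p. I +>\<^bsub>mpoly_ring\<^esub> p) ` supported ?E"
      by (simp add: quotient_module_def carrier onto)
    show "\<zero>\<^bsub>quotient_module I\<^esub> = I +>\<^bsub>mpoly_ring\<^esub> 0"
      using I.a_coset_add_zero[OF I.a_subset] by (simp add: quotient_module_def FactRing_def mpoly_ring_sel)
    show "(I +>\<^bsub>mpoly_ring\<^esub> p) \<oplus>\<^bsub>quotient_module I\<^esub> (I +>\<^bsub>mpoly_ring\<^esub> q) = I +>\<^bsub>mpoly_ring\<^esub> (p + q)" for p q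
      using I.a_rcos_sum[of p q] by (simp add: quotient_module_def FactRing_def mpoly_ring_sel)
    show "f \<odot>\<^bsub>quotient_module I\<^esub> (I +>\<^bsub>mpoly_ring\<^esub> p) = I +>\<^bsub>mpoly_ring\<^esub> restrict_to ?E (f * p)" for f p
      unfolding restrict by (simp add: quotient_module_def mult)
    show "(f * g) \<odot>\<^bsub>quotient_module I\<^esub> x = f \<odot>\<^bsub>quotient_module I\<^esub> (g \<odot>\<^bsub>quotient_module I\<^esub> x)"
      if "x \<in> carrier (quotient_module I)" for f g x
      using that by (auto simp: quotient_module_def carrier mult mult.assoc)
    show "homogeneous (quotient_module I) m \<longleftrightarrow>
        (\<exists>p\<in>supported ?E. (\<exists>d. p \<in> mpoly_part d) \<and> m = I +>\<^bsub>mpoly_ring\<^esub> p)" for m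
    proof
      assume "homogeneous (quotient_module I) m"
      then obtain d p where p: "p \<in> mpoly_part d" "m = I +>\<^bsub>mpoly_ring\<^esub> p"
        by (auto simp: homogeneous_def quotient_module_def)
      then have "restrict_to ?E p \<in> mpoly_part d"
        by (auto simp: mpoly_part_def in_keys_iff lookup_restrict_to split: if_splits)
      then show "\<exists>p\<in>supported ?E. (\<exists>d. p \<in> mpoly_part d) \<and> m = I +>\<^bsub>mpoly_ring\<^esub> p"
        using p(2) restrict[of p] restrict_to_supported[of ?E p] by metis
    next
      assume "\<exists>p\<in>supported ?E. (\<exists>d. p \<in> mpoly_part d) \<and> m = I +>\<^bsub>mpoly_ring\<^esub> p"
      then show "homogeneous (quotient_module I) m"
        by (auto simp: homogeneous_def quotient_module_def carrier)
    qed
    show "- F \<noteq> {}" by fact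
  qed
qed

theorem theorem12:
  fixes I :: "(5, 'k::field) mpoly set"
  assumes "squarefree_monomial_ideal I"
    and "I \<noteq> {0}" and "I \<noteq> UNIV"
  shows "sdepth (ideal_module I) > sdepth (quotient_module I)"
proof -
  obtain F where F: "up_closed F" "I = supported {e. Poly_Mapping.keys e \<in> F}"
    using assms(1) by (rule squarefree_monomial_ideal_supported)
  have "F \<noteq> {}"
    using assms(2) F(2) by (auto simp: supported_def)
  have "{} \<notin> F"
  proof
    assume "{} \<in> F"
    then have "F = UNIV" using up_closedD[OF F(1) _ empty_subsetI] by blast
    then show False using assms(3) F(2) by (simp add: supported_def)
  qed
  then have "- F \<noteq> {}" by blast
  interpret I: squarefree_module "ideal_module I" F "\<lambda>p. p"
    unfolding F(2) using F(1) \<open>F \<noteq> {}\<close> by (rule squarefree_module_ideal)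
  interpret Q: squarefree_module "quotient_module I" "- F" "\<lambda>p. I +>\<^bsub>mpoly_ring\<^esub> p"
    unfolding F(2) using F(1) \<open>- F \<noteq> {}\<close> by (rule squarefree_module_quotient)
  have "partitionable (sdepth (quotient_module I)) (- F)"
    using Q.le_sdepth_iff by blast
  then have "partitionable (Suc (sdepth (quotient_module I))) F"
    using complement_partitionable[OF F(1) \<open>F \<noteq> {}\<close> \<open>{} \<notin> F\<close>] by blast
  then have "Suc (sdepth (quotient_module I)) \<le> sdepth (ideal_module I)"
    unfolding I.le_sdepth_iff .
  then show ?thesis by simp
qed

end
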